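(* Suppose that $d=2$, $\mathbb{E}\|X\|<\infty$, and $\mu=\mathbf{0}$, where $\mu=\mathbb{E}X$. (i) We have $|\mathcal{D}|\ge \frac12|\mathbb{S}^1|$. (ii) If $X$ and $-X$ have the same distribution, then $\mathcal{D}=\mathbb{S}^1$.
   Context: Let $X,X_1,X_2,\ldots$ be i.i.d. random variables in $\mathbb{R}^d$ (here $d=2$), and let $S_0=\mathbf{0}$, $S_n=\sum_{k=1}^n X_k$ for $n\ge 1$, be the associated random walk. Standing assumption: the walk is genuinely $d$-dimensional, i.e. $\operatorname{supp}X$ is not contained in a $(d-1)$-dimensional (linear) subspace of $\mathbb{R}^d$. Here $\|\cdot\|$ is the Euclidean norm, $\mathbb{S}^{d-1}=\{\mathbf{x}\in\mathbb{R}^d:\|\mathbf{x}\|=1\}$, $\hat{\mathbf{x}}=\mathbf{x}/\|\mathbf{x}\|$ for $\mathbf{x}\neq\mathbf{0}$, and $\hat{\mathbf{0}}=\mathbf{0}$; write $\hat S_n$ for the image of $S_n$ under this map. The (non-random) set of a.s. recurrent directions is $\mathcal{D}=\{\mathbf{u}\in\mathbb{S}^{d-1}:\liminf_{n\to\infty}\|\hat S_n-\mathbf{u}\|=0 \text{ almost surely}\}$. For measurable $A\subseteq\mathbb{S}^{d-1}$, $|A|$ denotes the Haar (rotation-invariant) measure of $A$. *)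

theory Defs
  imports "HOL-Probability.Probability"
begin

text \<open>The family \<open>X 0, X 1, X 2, \<dots>\<close> is i.i.d.; \<open>X 0\<close> is the generic copy \<open>X\<close> and is not a
  step of the walk, whose steps are \<open>X 1, X 2, \<dots>\<close>.\<close>

definition random_walk :: "(nat \<Rightarrow> 'w \<Rightarrow> 'a::real_normed_vector) \<Rightarrow> nat \<Rightarrow> 'w \<Rightarrow> 'a" where
  "random_walk X n \<omega> = (\<Sum>k=1..n. X k \<omega>)"

definition iid :: "'w measure \<Rightarrow> (nat \<Rightarrow> 'w \<Rightarrow> 'a::euclidean_space) \<Rightarrow> bool" where
  "iid M X \<longleftrightarrow> prob_space.indep_vars M (\<lambda>_. borel) X UNIV \<and>
     (\<forall>k. distr M borel (X k) = distr M borel (X 0))"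

definition supp :: "'w measure \<Rightarrow> ('w \<Rightarrow> 'a::euclidean_space) \<Rightarrow> 'a set" where
  "supp M Y = {x. \<forall>U. open U \<longrightarrow> x \<in> U \<longrightarrow> emeasure (distr M borel Y) U > 0}"

definition genuinely_full_dim :: "'w measure \<Rightarrow> ('w \<Rightarrow> 'a::euclidean_space) \<Rightarrow> bool" where
  "genuinely_full_dim M Y \<longleftrightarrow>
     \<not> (\<exists>V. subspace V \<and> dim V = DIM('a) - 1 \<and> supp M Y \<subseteq> V)"

text \<open>The radial projection of \<open>x\<close>, with the convention that it sends \<open>0\<close> to \<open>0\<close>,
  is the library function \<^const>\<open>sgn\<close>. The lower limit is taken in the extended reals because
  \<^const>\<open>liminf\<close> requires a complete lattice.\<close>

definition recurrent_directions ::
    "'w measure \<Rightarrow> (nat \<Rightarrow> 'w \<Rightarrow> 'a::euclidean_space) \<Rightarrow> 'a set" where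
  "recurrent_directions M S =
     {u \<in> sphere 0 1. AE \<omega> in M. liminf (\<lambda>n. ereal (norm (sgn (S n \<omega>) - u))) = 0}"

text \<open>A Haar measure on the circle is a nonzero finite rotation-invariant Borel measure; this
  determines it up to a positive factor. No normalisation is fixed.\<close>

definition circle_haar :: "(real^2) measure \<Rightarrow> bool" where
  "circle_haar \<sigma> \<longleftrightarrow>
     sets \<sigma> = sets (restrict_space borel (sphere 0 1)) \<and>
     0 < emeasure \<sigma> (sphere 0 1) \<and> emeasure \<sigma> (sphere 0 1) < \<infinity> \<and>
     (\<forall>Q A. rotation_matrix Q \<longrightarrow> A \<in> sets \<sigma> \<longrightarrow>
        emeasure \<sigma> ((\<lambda>x. Q *v x) ` A) = emeasure \<sigma> A)"

text \<open>Existence: the image of Lebesgue measure on the punctured unit disc under radial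
  projection is such a measure.\<close>

lemma circle_haar_exists: "\<exists>\<sigma>. circle_haar \<sigma>"
proof -
  let ?S = "sphere 0 1 :: (real^2) set"
  define B where "B = ball 0 1 - {0 :: real^2}"
  define N where "N = restrict_space lborel B"
  define \<sigma> where "\<sigma> = distr N (restrict_space borel ?S) sgn"
  define P where "P A = {x \<in> B. sgn x \<in> A}" for A
  have Bb: "B \<in> sets borel" unfolding B_def by auto
  have spN: "space N = B" unfolding N_def by (simp add: space_restrict_space)
  have s0: "(sgn :: real^2 \<Rightarrow> real^2) \<in> borel_measurable borel"
    by (simp add: sgn_div_norm[abs_def])
  have sm: "sgn \<in> measurable N (restrict_space borel ?S)"
  proof (rule measurable_restrict_space2)
    show "sgn \<in> space N \<rightarrow> ?S"
      unfolding spN B_def by (auto simp: norm_sgn)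
    show "sgn \<in> borel_measurable N"
      unfolding N_def by (rule measurable_restrict_space1) (use s0 in simp)
  qed
  have sets\<sigma>: "sets \<sigma> = sets (restrict_space borel ?S)" unfolding \<sigma>_def by simp
  have em: "emeasure \<sigma> A = emeasure lborel (P A)" if "A \<in> sets \<sigma>" for A
  proof -
    have "emeasure \<sigma> A = emeasure N (sgn -` A \<inter> space N)"
      unfolding \<sigma>_def by (rule emeasure_distr[OF sm]) (use that sets\<sigma> in simp)
    also have "sgn -` A \<inter> space N = P A" unfolding P_def spN by auto
    also have "emeasure N (P A) = emeasure lborel (P A)"
      unfolding N_def by (rule emeasure_restrict_space) (use Bb in \<open>auto simp: P_def\<close>)
    finally show ?thesis .
  qed
  have setsP: "P A \<in> sets borel" if "A \<in> sets \<sigma>" for A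
  proof -
    have "A \<in> sets borel"
      using that unfolding sets\<sigma> by (subst (asm) sets_restrict_space_iff) auto
    then have "sgn -` A \<inter> space borel \<in> sets borel" using measurable_sets[OF s0] by simp
    moreover have "P A = (sgn -` A \<inter> space borel) \<inter> B" unfolding P_def by auto
    ultimately show ?thesis using Bb by auto
  qed
  have S: "?S \<in> sets \<sigma>" unfolding sets\<sigma> by (subst sets_restrict_space_iff) auto
  have PS: "P ?S = B" unfolding P_def B_def by (auto simp: norm_sgn)
  have eB: "emeasure lborel B = emeasure lborel (ball 0 1 :: (real^2) set)"
    unfolding B_def by (subst emeasure_Diff) auto
  have eB2: "emeasure lborel (ball 0 1 :: (real^2) set) = ennreal (measure lborel (ball 0 1 :: (real^2) set))"
    by (rule emeasure_eq_ennreal_measure) (use emeasure_lborel_ball_finite[of "0::real^2" 1] in auto)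
  have mpos: "measure lborel (ball 0 1 :: (real^2) set) > 0"
    using content_ball_pos[of 1 "0::real^2"] by simp
  have pos: "0 < emeasure \<sigma> ?S" "emeasure \<sigma> ?S < \<infinity>"
    unfolding em[OF S] PS eB eB2 using mpos by auto
  have inv: "emeasure \<sigma> ((\<lambda>x. Q *v x) ` A) = emeasure \<sigma> A"
    if Q: "rotation_matrix Q" and A: "A \<in> sets \<sigma>" for Q A
  proof -
    define R where "R = Finite_Cartesian_Product.transpose Q"
    let ?f = "\<lambda>x. Q *v x" and ?g = "\<lambda>x. R *v x"
    have om: "orthogonal_matrix Q" using Q by (simp add: rotation_matrix_def)
    have of: "orthogonal_transformation ?f"
      using om by (simp add: orthogonal_transformation_matrix)
    have gf: "?g (?f x) = x" "?f (?g x) = x" for x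
      using om by (simp_all only: R_def orthogonal_matrix_def matrix_vector_mul_assoc matrix_vector_mul_lid)
    have nf: "norm (?f x) = norm x" for x
      using of by (simp add: orthogonal_transformation)
    have ng: "norm (?g x) = norm x" for x using nf[of "?g x"] gf by simp
    have sf: "sgn (?f x) = ?f (sgn x)" for x
      by (simp add: sgn_div_norm nf matrix_vector_mult_scaleR)
    have AS: "A \<subseteq> ?S" and Ab: "A \<in> sets borel"
      using A unfolding sets\<sigma> by (subst (asm) sets_restrict_space_iff; auto)+
    have im: "?f ` C = ?g -` C" for C
      using gf by (auto simp: image_iff) metis
    have gm: "?g \<in> borel_measurable borel"
      by (intro borel_measurable_continuous_onI linear_continuous_on
          matrix_vector_mul_bounded_linear)
    have "?f ` A \<in> sets borel" unfolding im using measurable_sets[OF gm Ab] by simp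
    moreover have "?f ` A \<subseteq> ?S" using AS nf by auto
    ultimately have fA: "?f ` A \<in> sets \<sigma>"
      unfolding sets\<sigma> by (subst sets_restrict_space_iff) auto
    have "P (?f ` A) = ?f ` P A"
    proof (intro set_eqI iffI)
      fix x assume x: "x \<in> P (?f ` A)"
      have "x = ?f (?g x)" using gf by simp
      moreover have "?g x \<in> P A"
      proof -
        obtain a where a: "a \<in> A" "sgn x = ?f a" using x unfolding P_def by auto
        have "?f (sgn (?g x)) = ?f a" using sf[of "?g x"] gf a by simp
        then have "sgn (?g x) = a" using gf by metis
        moreover have "?g x \<in> B"
          using x ng[of x] unfolding P_def B_def
          by (simp add: dist_norm) (metis norm_eq_zero)
        ultimately show ?thesis using a unfolding P_def by simp
      qed
      ultimately show "x \<in> ?f ` P A" by blast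
    next
      fix x assume "x \<in> ?f ` P A"
      then obtain y where y: "y \<in> P A" "x = ?f y" by auto
      then show "x \<in> P (?f ` A)"
        using nf[of y] unfolding P_def B_def
        by (simp add: sf dist_norm) (metis norm_eq_zero)
    qed
    moreover have "emeasure lborel (?f ` P A) = emeasure lborel (P A)"
    proof -
      have pb: "P A \<in> sets borel" using setsP[OF A] .
      have fpb: "?f ` P A \<in> sets borel" using setsP[OF fA] calculation by simp
      have bd: "bounded (P A)" by (rule bounded_subset[OF bounded_ball[of 0 1]]) (auto simp: P_def B_def)
      have lm: "P A \<in> lmeasurable"
        using bd pb by (simp add: bounded_set_imp_lmeasurable)
      have "emeasure lebesgue (?f ` P A) = emeasure lebesgue (P A)"
        using measurable_orthogonal_image[OF of lm] measure_orthogonal_image[OF of lm] lm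
        by (simp add: emeasure_eq_measure2)
      then show ?thesis using pb fpb by simp
    qed
    ultimately show ?thesis using em[OF A] em[OF fA] by simp
  qed
  have "circle_haar \<sigma>" unfolding circle_haar_def using sets\<sigma> pos inv by blast
  then show ?thesis ..
qed

end

theory Submission
  imports Defs
begin

text \<open>
  Fix a unit vector \<open>u\<close> in the plane and a unit vector \<open>v\<close> orthogonal to it. The main point is that,
  with probability one, \<open>u\<close> or \<open>- u\<close> is a limit point of the directions of the walk. By a zero-one
  law one of the two is then a recurrent direction, so the set of recurrent directions and its
  antipodal image cover the circle. The set is closed and the antipodal map is a rotation; hence
  the set has at least half the measure. If the step law is symmetric, then so is the set of
  recurrent directions, and it is the whole circle.

  For the main point, consider the one-dimensional walk \<open>v \<bullet> walk \<omega> n\<close>. It is centred and integrable,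
  hence it returns infinitely often to the strip around the line spanned by \<open>u\<close>
  (\<open>strip_visited_infinitely_often\<close>). The proof counts the positions that the walk never comes close
  to again: they are far apart from each other, and by the law of large numbers the walk has
  travelled only a distance \<open>o(n)\<close> at time \<open>n\<close>, so there is no room for a positive proportion of
  them. Returning to the strip does not yet give the direction \<open>u\<close>, as the returns may happen near
  the origin. But the steps are not confined to a line and are centred, so the origin is an interior
  point of the convex hull of their support, and the walk can reach positions that are arbitrarily
  far away and yet at bounded distance from the line (\<open>steep_position_possible\<close>). If with positive
  probability the walk avoided a double cone around that line for ever, it would come back to a
  bounded set infinitely often and at each return have a fixed chance to jump into the cone, which
  is impossible (\<open>prob_confined_eq_0\<close>).

  The zero-one law is applied to the event \<open>steep\<close>, that \<open>u \<bullet> walk \<omega> n\<close> is not bounded by any multiple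
  of \<open>1 + \<bar>v \<bullet> walk \<omega> n\<bar>\<close>. This event forces the directions to accumulate at \<open>u\<close>, and it is
  invariant under the time shift.
\<close>

section \<open>Centred sums with a first moment\<close>

text \<open>The weak law of large numbers in \<open>L\<^sup>1\<close>, in the form in which it is summed over times below: the
mean absolute value grows by at most \<open>d\<close> per step, up to a constant. Only first moments are
available, so each variable is split into a bounded centred part, whose partial sums have variance
linear in \<open>n\<close> by orthogonality, and a remainder of mean absolute value at most \<open>d/2\<close>.\<close>

lemma (in prob_space) centered_sum_L1_bound:
  fixes Y :: "nat \<Rightarrow> 'a \<Rightarrow> real" and d :: real
  assumes indep: "indep_vars (\<lambda>_. borel) Y UNIV"
    and law: "\<And>i. distr M borel (Y i) = distr M borel (Y 0)"
    and int: "integrable M (Y 0)" and mean: "expectation (Y 0) = 0"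
    and d: "d > 0"
  obtains C where "\<And>n. expectation (\<lambda>\<omega>. \<bar>\<Sum>i<n. Y i \<omega>\<bar>) \<le> d * n + C"
proof -
  have Ym [measurable]: "Y i \<in> borel_measurable M" for i
    using indep by (auto simp: indep_vars_def2)
  have same: "expectation (\<lambda>\<omega>. h (Y i \<omega>)) = expectation (\<lambda>\<omega>. h (Y 0 \<omega>))"
    if [measurable]: "h \<in> borel_measurable borel" for h :: "real \<Rightarrow> real" and i
  proof -
    have "expectation (\<lambda>\<omega>. h (Y i \<omega>)) = (LINT y|distr M borel (Y i). h y)"
      by (subst integral_distr) auto
    also have "\<dots> = expectation (\<lambda>\<omega>. h (Y 0 \<omega>))"
      by (subst law, subst integral_distr) auto
    finally show ?thesis .
  qed
  have sameint: "integrable M (\<lambda>\<omega>. h (Y i \<omega>)) \<longleftrightarrow> integrable M (\<lambda>\<omega>. h (Y 0 \<omega>))"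
    if [measurable]: "h \<in> borel_measurable borel" for h :: "real \<Rightarrow> real" and i
    using integrable_distr_eq[of "Y i" M borel h] integrable_distr_eq[of "Y 0" M borel h] law[of i]
    by simp
  define t where "t B y = (if \<bar>y\<bar> \<le> B then y else 0 :: real)" for B y
  have tm [measurable]: "t B \<in> borel_measurable borel" for B unfolding t_def by measurable
  have tb: "\<bar>t B y\<bar> \<le> \<bar>B\<bar>" "\<bar>t B y\<bar> \<le> \<bar>y\<bar>" "\<bar>y - t B y\<bar> \<le> \<bar>y\<bar>" for B y by (auto simp: t_def)
  have "(\<lambda>j. expectation (\<lambda>\<omega>. \<bar>Y 0 \<omega> - t (real j) (Y 0 \<omega>)\<bar>)) \<longlonglongrightarrow> expectation (\<lambda>\<omega>. 0)"
  proof (rule integral_dominated_convergence[where w="\<lambda>\<omega>. \<bar>Y 0 \<omega>\<bar>"])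
    show "AE \<omega> in M. (\<lambda>j. \<bar>Y 0 \<omega> - t (real j) (Y 0 \<omega>)\<bar>) \<longlonglongrightarrow> 0"
    proof (rule AE_I2)
      fix \<omega>
      obtain N where "\<bar>Y 0 \<omega>\<bar> \<le> real N" using real_arch_simple by blast
      then have "\<forall>\<^sub>F j in sequentially. \<bar>Y 0 \<omega> - t (real j) (Y 0 \<omega>)\<bar> = 0"
        by (intro eventually_sequentiallyI[of N]) (auto simp: t_def)
      then show "(\<lambda>j. \<bar>Y 0 \<omega> - t (real j) (Y 0 \<omega>)\<bar>) \<longlonglongrightarrow> 0" by (rule tendsto_eventually)
    qed
  qed (use int tb in auto)
  then have "(\<lambda>j. expectation (\<lambda>\<omega>. \<bar>Y 0 \<omega> - t (real j) (Y 0 \<omega>)\<bar>)) \<longlonglongrightarrow> 0" by simp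
  \<comment> \<open>The remainder has mean absolute value below \<open>d/4\<close>; recentring by \<open>m\<close> costs at most another \<open>d/4\<close>.\<close>
  from order_tendstoD(2)[OF this, of "d/4"] d obtain j :: nat
    where j: "expectation (\<lambda>\<omega>. \<bar>Y 0 \<omega> - t (real j) (Y 0 \<omega>)\<bar>) < d/4"
    by (auto simp: eventually_sequentially)
  define B where "B = real j"
  define m where "m = expectation (\<lambda>\<omega>. t B (Y 0 \<omega>))"
  define U where "U i \<omega> = t B (Y i \<omega>) - m" for i \<omega>
  have Um [measurable]: "U i \<in> borel_measurable M" for i unfolding U_def by measurable
  have tint: "integrable M (\<lambda>\<omega>. t B (Y i \<omega>))" for i
    by (rule integrable_const_bound[where B=B]) (use tb(1)[of B] in \<open>auto simp: B_def\<close>)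
  have Yint: "integrable M (Y i)" for i
    using sameint[of "\<lambda>y. y" i] int by simp
  have mB: "\<bar>m\<bar> \<le> B"
  proof -
    have "\<bar>m\<bar> \<le> expectation (\<lambda>\<omega>. \<bar>t B (Y 0 \<omega>)\<bar>)" unfolding m_def by (rule integral_abs_bound)
    also have "\<dots> \<le> expectation (\<lambda>\<omega>. B)"
      by (rule integral_mono) (use tint tb B_def in \<open>auto intro: order.trans[OF tb(1)]\<close>)
    finally show ?thesis by (simp add: prob_space)
  qed
  have md: "\<bar>m\<bar> \<le> d/4"
  proof -
    have "m = - expectation (\<lambda>\<omega>. Y 0 \<omega> - t B (Y 0 \<omega>))"
      unfolding m_def using mean int tint[of 0] by simp
    also have "\<bar>\<dots>\<bar> \<le> expectation (\<lambda>\<omega>. \<bar>Y 0 \<omega> - t B (Y 0 \<omega>)\<bar>)"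
      using integral_abs_bound[of M "\<lambda>\<omega>. Y 0 \<omega> - t B (Y 0 \<omega>)"] by simp
    finally show ?thesis using j unfolding B_def by simp
  qed
  have Ub: "\<bar>U i \<omega>\<bar> \<le> 2 * B" for i \<omega>
    using tb(1)[of B "Y i \<omega>"] mB B_def unfolding U_def by auto
  have U0: "expectation (U i) = 0" for i
    unfolding U_def using tint[of i] same[of "t B" i] by (simp add: m_def prob_space)
  have Uind: "indep_vars (\<lambda>_. borel) U UNIV"
    unfolding U_def by (rule indep_vars_compose2[OF indep]) auto
  define V where "V n \<omega> = (\<Sum>i<n. U i \<omega>)" for n \<omega>
  have Vm [measurable]: "V n \<in> borel_measurable M" for n unfolding V_def by measurable
  have Vb: "\<bar>V n \<omega>\<bar> \<le> n * (2 * B)" for n \<omega>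
  proof -
    have "\<bar>V n \<omega>\<bar> \<le> (\<Sum>i<n. \<bar>U i \<omega>\<bar>)" unfolding V_def by (rule sum_abs)
    also have "\<dots> \<le> (\<Sum>i<n. 2 * B)" by (rule sum_mono) (rule Ub)
    finally show ?thesis by simp
  qed
  have bint: "integrable M f" if "f \<in> borel_measurable M" "\<And>\<omega>. \<bar>f \<omega>\<bar> \<le> c" for f :: "'a \<Rightarrow> real" and c
    by (rule integrable_const_bound[where B=c]) (use that in auto)
  have sq: "x\<^sup>2 \<le> c\<^sup>2" if "\<bar>x\<bar> \<le> c" for x c :: real
    using power_mono[OF that, of 2] by simp
  have Vint: "integrable M (V n)" for n by (rule bint[OF Vm Vb])
  have Uint: "integrable M (U n)" for n by (rule bint[OF Um Ub])
  have V2int: "integrable M (\<lambda>\<omega>. (V n \<omega>)\<^sup>2)" for n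
    by (rule bint[of "\<lambda>\<omega>. (V n \<omega>)\<^sup>2" "(n * (2 * B))\<^sup>2"]) (use sq[OF Vb] in auto)
  have U2int: "integrable M (\<lambda>\<omega>. (U n \<omega>)\<^sup>2)" for n
    by (rule bint[of "\<lambda>\<omega>. (U n \<omega>)\<^sup>2" "(2 * B)\<^sup>2"]) (use sq[OF Ub] in auto)
  have U2: "expectation (\<lambda>\<omega>. (U n \<omega>)\<^sup>2) \<le> (2 * B)\<^sup>2" for n
  proof -
    have "expectation (\<lambda>\<omega>. (U n \<omega>)\<^sup>2) \<le> expectation (\<lambda>\<omega>. (2 * B)\<^sup>2)"
      by (rule integral_mono[OF U2int]) (use sq[OF Ub] in auto)
    then show ?thesis by (simp add: prob_space)
  qed
  have V2: "expectation (\<lambda>\<omega>. (V n \<omega>)\<^sup>2) \<le> n * (2 * B)\<^sup>2" for n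
  proof (induction n)
    case 0 then show ?case by (simp add: V_def)
  next
    case (Suc n)
    have ind: "indep_var borel (U n) borel (V n)"
      unfolding V_def by (rule indep_vars_sum) (auto intro: indep_vars_subset[OF Uind])
    have "integrable M (\<lambda>\<omega>. U n \<omega> * V n \<omega>)"
      by (rule indep_var_integrable[OF ind Uint Vint])
    moreover have "expectation (\<lambda>\<omega>. U n \<omega> * V n \<omega>) = 0"
      using indep_var_lebesgue_integral[OF ind Uint Vint] U0 by simp
    moreover have "(V (Suc n) \<omega>)\<^sup>2 = (V n \<omega>)\<^sup>2 + (U n \<omega>)\<^sup>2 + 2 * (U n \<omega> * V n \<omega>)" for \<omega>
      by (simp add: V_def power2_eq_square algebra_simps)
    ultimately have "expectation (\<lambda>\<omega>. (V (Suc n) \<omega>)\<^sup>2)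
        = expectation (\<lambda>\<omega>. (V n \<omega>)\<^sup>2) + expectation (\<lambda>\<omega>. (U n \<omega>)\<^sup>2)"
      using V2int[of n] U2int[of n] by simp
    then show ?case using Suc U2[of n] by (simp add: algebra_simps)
  qed
  define s where "s = d / (2 * ((2 * B)\<^sup>2 + 1))"
  have s: "s > 0" "s * (2 * B)\<^sup>2 \<le> d/2"
  proof -
    have p: "(2 * B)\<^sup>2 + 1 > 0" by (rule add_nonneg_pos) auto
    show "s > 0" unfolding s_def using d p by (intro divide_pos_pos mult_pos_pos) auto
    have "d * (2 * B)\<^sup>2 \<le> d * ((2 * B)\<^sup>2 + 1)" using d by simp
    then show "s * (2 * B)\<^sup>2 \<le> d/2" unfolding s_def using p by (simp add: field_simps)
  qed
  have EV: "expectation (\<lambda>\<omega>. \<bar>V n \<omega>\<bar>) \<le> d/2 * n + 1/s" for n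
  proof -
    \<comment> \<open>The quadratic bound stands in for Cauchy-Schwarz: \<open>s\<close> was chosen so small that the variance
      term contributes at most \<open>d/2\<close> per step.\<close>
    have amgm: "\<bar>x\<bar> \<le> s * x\<^sup>2 + 1/s" for x :: real
    proof -
      have "0 \<le> (s * \<bar>x\<bar> - 1)\<^sup>2 + s * \<bar>x\<bar>" using s by (intro add_nonneg_nonneg mult_nonneg_nonneg) auto
      also have "\<dots> = s * (s * x\<^sup>2 + 1/s - \<bar>x\<bar>)" using s by (simp add: power2_eq_square field_simps)
      finally show ?thesis using s by (simp add: zero_le_mult_iff)
    qed
    have "expectation (\<lambda>\<omega>. \<bar>V n \<omega>\<bar>) \<le> expectation (\<lambda>\<omega>. s * (V n \<omega>)\<^sup>2 + 1/s)"
      by (rule integral_mono) (use Vint V2int amgm in auto)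
    also have "\<dots> = s * expectation (\<lambda>\<omega>. (V n \<omega>)\<^sup>2) + 1/s" using V2int by (simp add: prob_space)
    also have "\<dots> \<le> s * (n * (2 * B)\<^sup>2) + 1/s" using V2 s by simp
    also have "\<dots> = s * (2 * B)\<^sup>2 * n + 1/s" by simp
    also have "\<dots> \<le> d/2 * n + 1/s" using s by (intro add_right_mono mult_right_mono) auto
    finally show ?thesis .
  qed
  have "expectation (\<lambda>\<omega>. \<bar>\<Sum>i<n. Y i \<omega>\<bar>) \<le> d * n + 1/s" for n
  proof -
    have Zint: "integrable M (\<lambda>\<omega>. \<bar>Y i \<omega> - U i \<omega>\<bar>)" for i using Yint Uint by auto
    have Z: "expectation (\<lambda>\<omega>. \<bar>Y i \<omega> - U i \<omega>\<bar>) \<le> d/2" for i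
    proof -
      have "expectation (\<lambda>\<omega>. \<bar>Y i \<omega> - U i \<omega>\<bar>) = expectation (\<lambda>\<omega>. \<bar>Y 0 \<omega> - U 0 \<omega>\<bar>)"
        using same[of "\<lambda>y. \<bar>y - (t B y - m)\<bar>" i] by (simp add: U_def)
      also have "\<dots> \<le> expectation (\<lambda>\<omega>. \<bar>Y 0 \<omega> - t B (Y 0 \<omega>)\<bar> + d/4)"
        by (rule integral_mono) (use Zint int tint[of 0] md in \<open>auto simp: U_def\<close>)
      also have "\<dots> \<le> d/2" using int tint[of 0] j unfolding B_def by (simp add: prob_space)
      finally show ?thesis .
    qed
    have "expectation (\<lambda>\<omega>. \<bar>\<Sum>i<n. Y i \<omega>\<bar>)
        \<le> expectation (\<lambda>\<omega>. \<bar>V n \<omega>\<bar> + (\<Sum>i<n. \<bar>Y i \<omega> - U i \<omega>\<bar>))"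
    proof (rule integral_mono)
      fix \<omega>
      have "(\<Sum>i<n. Y i \<omega>) = V n \<omega> + (\<Sum>i<n. Y i \<omega> - U i \<omega>)" by (simp add: V_def sum_subtractf)
      then have "\<bar>\<Sum>i<n. Y i \<omega>\<bar> \<le> \<bar>V n \<omega>\<bar> + \<bar>\<Sum>i<n. Y i \<omega> - U i \<omega>\<bar>" by linarith
      also have "\<bar>\<Sum>i<n. Y i \<omega> - U i \<omega>\<bar> \<le> (\<Sum>i<n. \<bar>Y i \<omega> - U i \<omega>\<bar>)" by (rule sum_abs)
      finally show "\<bar>\<Sum>i<n. Y i \<omega>\<bar> \<le> \<bar>V n \<omega>\<bar> + (\<Sum>i<n. \<bar>Y i \<omega> - U i \<omega>\<bar>)" by simp
    qed (use Yint Uint Vint in auto)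
    also have "\<dots> = expectation (\<lambda>\<omega>. \<bar>V n \<omega>\<bar>) + (\<Sum>i<n. expectation (\<lambda>\<omega>. \<bar>Y i \<omega> - U i \<omega>\<bar>))"
      using Vint Zint by (simp add: integral_sum)
    also have "\<dots> \<le> (d/2 * n + 1/s) + (\<Sum>i<n. d/2)"
      by (intro add_mono EV sum_mono Z)
    finally show ?thesis by (simp add: algebra_simps)
  qed
  then show ?thesis by (rule that)
qed

section \<open>Independent steps and the time shift\<close>

definition walk :: "(nat \<Rightarrow> 'a::real_normed_vector) \<Rightarrow> nat \<Rightarrow> 'a" where
  "walk \<omega> n = (\<Sum>i<n. \<omega> i)"

definition steps_from :: "nat \<Rightarrow> (nat \<Rightarrow> 'a) \<Rightarrow> nat \<Rightarrow> 'a" where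
  "steps_from k \<omega> i = \<omega> (k + i)"

lemma walk_0 [simp]: "walk \<omega> 0 = 0"
  by (simp add: walk_def)

lemma walk_shift: "walk (steps_from k \<omega>) m = walk \<omega> (k + m) - walk \<omega> k"
  by (induction m) (simp_all add: walk_def steps_from_def algebra_simps)

lemma walk_cong: "(\<And>i. i < k \<Longrightarrow> \<omega> i = \<omega>' i) \<Longrightarrow> n \<le> k \<Longrightarrow> walk \<omega> n = walk \<omega>' n"
  by (simp add: walk_def)

lemma shift_comb_seq: "steps_from k (comb_seq k \<omega> \<omega>') = \<omega>'"
  by (simp add: steps_from_def comb_seq_def fun_eq_iff)

text \<open>The canonical model: the space of all step sequences under the product measure. Here the time shift
is a map of the sample space, which makes the Markov property and shift invariance easy to state.\<close>

locale random_steps = sequence_space Q for Q :: "'a::euclidean_space measure" +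
  assumes sets_Q [measurable_cong]: "sets Q = sets borel"
begin

lemma space_S [simp]: "space S = UNIV"
  using sets_eq_imp_space_eq[OF sets_Q] by (simp add: space_PiM PiE_UNIV_domain)

lemma prob_UNIV [simp]: "P.prob UNIV = 1"
  using P.prob_space by simp

lemma pred_sets: "Measurable.pred S p \<Longrightarrow> {\<omega>. p \<omega>} \<in> sets S"
  by (drule predE) simp

lemma measurable_step [measurable]: "(\<lambda>\<omega>. \<omega> i) \<in> borel_measurable S"
  by measurable

lemma measurable_walk [measurable]: "(\<lambda>\<omega>. walk \<omega> n) \<in> borel_measurable S"
  unfolding walk_def by measurable

lemma measurable_shift [measurable]: "steps_from k \<in> measurable S S"
  unfolding steps_from_def [abs_def] by (rule measurable_abs_UNIV) (rule measurable_component_singleton, simp)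

text \<open>The Markov property at a fixed time: the steps from time \<open>k\<close> on are independent of the first \<open>k\<close>
steps and have the original law. Gluing the first \<open>k\<close> steps of one sequence to a second,
independent sequence preserves the product measure and turns the event into a rectangle.\<close>

lemma prob_past_future:
  assumes A: "A \<in> sets S" and B: "B \<in> sets S"
    and past: "\<And>\<omega> \<omega>'. (\<And>i. i < k \<Longrightarrow> \<omega> i = \<omega>' i) \<Longrightarrow> \<omega> \<in> A \<Longrightarrow> \<omega>' \<in> A"
  shows "P.prob {\<omega>. \<omega> \<in> A \<and> steps_from k \<omega> \<in> B} = P.prob A * P.prob B"
proof -
  let ?C = "{\<omega>. \<omega> \<in> A \<and> steps_from k \<omega> \<in> B}" and ?c = "\<lambda>(\<omega>, \<omega>'). comb_seq k \<omega> \<omega>'"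
  have C: "?C \<in> sets S"
    by (rule pred_sets) (use A B in measurable)
  have "comb_seq k \<omega> \<omega>' \<in> A \<longleftrightarrow> \<omega> \<in> A" for \<omega> \<omega>'
    using past[of "comb_seq k \<omega> \<omega>'" \<omega>] past[of \<omega> "comb_seq k \<omega> \<omega>'"]
    by (auto simp: comb_seq_def)
  then have pre: "?c -` ?C \<inter> space (S \<Otimes>\<^sub>M S) = A \<times> B"
    by (auto simp: shift_comb_seq space_pair_measure)
  have "emeasure S ?C = emeasure (distr (S \<Otimes>\<^sub>M S) S ?c) ?C"
    by (simp add: PiM_comb_seq)
  also have "\<dots> = emeasure (S \<Otimes>\<^sub>M S) (A \<times> B)"
    by (subst emeasure_distr[OF measurable_comb_seq C]) (simp only: pre)
  also have "\<dots> = emeasure S A * emeasure S B"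
    by (rule P.emeasure_pair_measure_Times[OF A B])
  finally show ?thesis
    by (simp add: measure_def enn2real_mult)
qed

lemma prob_shift:
  assumes "B \<in> sets S"
  shows "P.prob {\<omega>. steps_from k \<omega> \<in> B} = P.prob B"
  using prob_past_future[of UNIV B k] assms sets.top[of S] P.prob_space by simp

text \<open>If an invariant event \<open>A\<close> has positive probability, then conditioning on it does not change the
probability of any cylinder, because a cylinder depends on finitely many steps while \<open>A\<close> can be
read off from the later ones. Hence the conditional measure is the product measure itself, and
\<open>A\<close> has probability one.\<close>

lemma shift_invariant_zero_one:
  assumes A: "A \<in> sets S" and inv: "\<And>k \<omega>. steps_from k \<omega> \<in> A \<longleftrightarrow> \<omega> \<in> A"
  shows "(AE \<omega> in S. \<omega> \<in> A) \<or> (AE \<omega> in S. \<omega> \<notin> A)"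
proof (cases "P.prob A = 0")
  case True
  then have "A \<in> null_sets S" using A by (simp add: null_sets_def P.emeasure_eq_measure)
  then show ?thesis by (auto dest: AE_not_in)
next
  case False
  let ?N = "uniform_measure S A"
  have pos: "P.prob A > 0" using False by (simp add: zero_less_measure_iff)
  have "?N = S"
  proof (rule PiM_eq)
    fix J F assume J: "finite J" "J \<subseteq> (UNIV :: nat set)" "\<And>j. j \<in> J \<Longrightarrow> F j \<in> sets Q"
    let ?E = "prod_emb UNIV (\<lambda>_. Q) J (\<Pi>\<^sub>E j\<in>J. F j)"
    have E: "?E \<in> sets S" using J by (auto intro!: sets_PiM_I)
    obtain k where k: "\<And>j. j \<in> J \<Longrightarrow> j < k"
      using finite_nat_set_iff_bounded[of J] J by auto
    have "P.prob {\<omega>. \<omega> \<in> ?E \<and> steps_from k \<omega> \<in> A} = P.prob ?E * P.prob A"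
    proof (rule prob_past_future[OF E A])
      fix \<omega> \<omega>' assume eq: "\<And>i. i < k \<Longrightarrow> \<omega> i = \<omega>' i" and "\<omega> \<in> ?E"
      then show "\<omega>' \<in> ?E"
        using k sets_eq_imp_space_eq[OF sets_Q] by (auto simp: prod_emb_def PiE_iff)
    qed
    moreover have "{\<omega>. \<omega> \<in> ?E \<and> steps_from k \<omega> \<in> A} = A \<inter> ?E" using inv by auto
    ultimately have "P.prob (A \<inter> ?E) = P.prob ?E * P.prob A" by simp
    then have "emeasure ?N ?E = ennreal (P.prob ?E)"
      using emeasure_uniform_measure[OF A E] pos
      by (simp add: P.emeasure_eq_measure divide_ennreal)
    also have "\<dots> = (\<Prod>j\<in>J. emeasure Q (F j))"
      using emeasure_PiM_emb[of J F] J by (simp add: P.emeasure_eq_measure)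
    finally show "emeasure ?N ?E = (\<Prod>j\<in>J. emeasure Q (F j))" .
  qed simp
  then have "emeasure S A = emeasure ?N A" by simp
  also have "\<dots> = 1"
    using A pos by (simp add: emeasure_uniform_measure P.emeasure_eq_measure divide_ennreal)
  finally have "P.prob A = 1" by (simp add: P.emeasure_eq_measure)
  then show ?thesis using A P.AE_in_set_eq_1 by blast
qed

lemma distr_step: "distr S borel (\<lambda>\<omega>. \<omega> i) = Q"
proof -
  have "distr S borel (\<lambda>\<omega>. \<omega> i) = distr S Q (\<lambda>\<omega>. \<omega> i)"
    by (rule distr_cong) (simp_all add: sets_Q)
  then show ?thesis using PiM_component[of i] by simp
qed

lemma indep_steps: "P.indep_vars (\<lambda>_. borel) (\<lambda>i \<omega>. \<omega> i) UNIV"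
proof (subst P.indep_vars_iff_distr_eq_PiM')
  have "distr S (Pi\<^sub>M UNIV (\<lambda>_::nat. borel)) (\<lambda>\<omega>. \<omega>) = S"
    by (rule distr_id2) (intro sets_PiM_cong, simp_all add: sets_Q)
  then show "distr S (Pi\<^sub>M UNIV (\<lambda>_::nat. borel)) (\<lambda>\<omega>. \<lambda>i\<in>UNIV. \<omega> i)
      = Pi\<^sub>M UNIV (\<lambda>i. distr S borel (\<lambda>\<omega>. \<omega> i))"
    by (simp add: distr_step restrict_UNIV)
qed simp_all

end

section \<open>Recurrence of one-dimensional projections\<close>

text \<open>Dividing by \<open>r\<close> and rounding down is injective on separated points.\<close>

lemma card_separated_le:
  fixes x :: "nat \<Rightarrow> real"
  assumes fin: "finite I" and r: "r > 0" and c: "c \<ge> 0"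
    and bd: "\<And>k. k \<in> I \<Longrightarrow> \<bar>x k\<bar> \<le> c"
    and sep: "\<And>k l. k \<in> I \<Longrightarrow> l \<in> I \<Longrightarrow> k < l \<Longrightarrow> r \<le> \<bar>x l - x k\<bar>"
  shows "real (card I) \<le> 2 * c / r + 2"
proof -
  let ?f = "\<lambda>k. \<lfloor>x k / r\<rfloor>"
  have "inj_on ?f I"
  proof (rule linorder_inj_onI)
    fix k l assume kl: "k < l" "k \<in> I" "l \<in> I"
    show "?f k \<noteq> ?f l"
    proof
      assume "?f k = ?f l"
      then have "\<bar>x l / r - x k / r\<bar> < 1" by linarith
      then have "\<bar>x l - x k\<bar> < r" using r by (simp add: abs_less_iff field_simps)
      then show False using sep[of k l] kl by simp
    qed
  qed auto
  moreover have "?f ` I \<subseteq> {\<lfloor>- c / r\<rfloor>..\<lfloor>c / r\<rfloor>}"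
  proof
    fix y assume "y \<in> ?f ` I"
    then obtain k where k: "k \<in> I" "y = ?f k" by auto
    have "- c / r \<le> x k / r" "x k / r \<le> c / r"
      using bd[OF k(1)] r divide_right_mono[of "- c" "x k" r] divide_right_mono[of "x k" c r]
      by (simp_all add: abs_le_iff)
    then show "y \<in> {\<lfloor>- c / r\<rfloor>..\<lfloor>c / r\<rfloor>}" using k by (auto intro: floor_mono)
  qed
  ultimately have "card I \<le> card {\<lfloor>- c / r\<rfloor>..\<lfloor>c / r\<rfloor>}" by (intro card_inj_on_le) auto
  moreover have "\<lfloor>- c / r\<rfloor> \<le> \<lfloor>c / r\<rfloor>" using r c by (intro floor_mono divide_right_mono) auto
  ultimately have "real (card I) \<le> of_int (\<lfloor>c / r\<rfloor> - \<lfloor>- c / r\<rfloor> + 1)" by simp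
  also have "\<dots> \<le> c / r + (c / r + 1) + 1" by (simp add: floor_le_iff) linarith
  finally show ?thesis by simp
qed

locale centered_steps = random_steps +
  assumes integrable_Q: "integrable Q (\<lambda>x. x)" and mean_Q: "(LINT x|Q. x) = 0"
begin

lemma walk_L1_bound:
  fixes d :: real
  assumes "d > 0"
  obtains C where "\<And>n. P.expectation (\<lambda>\<omega>. \<bar>v \<bullet> walk \<omega> n\<bar>) \<le> d * n + C"
proof -
  let ?Y = "\<lambda>i \<omega>. v \<bullet> \<omega> i"
  have eq: "distr S borel (?Y i) = distr Q borel (\<lambda>x. v \<bullet> x)" for i
  proof -
    have "distr Q borel (\<lambda>x. v \<bullet> x) = distr (distr S borel (\<lambda>\<omega>. \<omega> i)) borel (\<lambda>x. v \<bullet> x)"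
      by (simp add: distr_step)
    also have "\<dots> = distr S borel (?Y i)" by (subst distr_distr) (simp_all add: comp_def)
    finally show ?thesis by simp
  qed
  have "integrable S (?Y 0) \<longleftrightarrow> integrable Q (\<lambda>x. v \<bullet> x)"
    using integrable_distr_eq[of "\<lambda>\<omega>. \<omega> 0" S borel "\<lambda>x. v \<bullet> x"] by (simp add: distr_step)
  then have int: "integrable S (?Y 0)" using integrable_Q by simp
  have "P.expectation (?Y 0) = (LINT x|Q. v \<bullet> x)"
    using integral_distr[of "\<lambda>\<omega>. \<omega> 0" S borel "\<lambda>x. v \<bullet> x"] by (simp add: distr_step)
  also have "\<dots> = 0" using integrable_Q mean_Q by simp
  finally have mean: "P.expectation (?Y 0) = 0" .
  have "P.indep_vars (\<lambda>_. borel) ?Y UNIV"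
    by (rule P.indep_vars_compose2[OF indep_steps]) simp
  from P.centered_sum_L1_bound[OF this _ int mean assms] obtain C
    where "\<And>n. P.expectation (\<lambda>\<omega>. \<bar>\<Sum>i<n. v \<bullet> \<omega> i\<bar>) \<le> d * n + C"
    using eq by metis
  then show ?thesis by (intro that[of C]) (simp add: walk_def inner_sum_right)
qed

lemma integrable_walk_inner: "integrable S (\<lambda>\<omega>. v \<bullet> walk \<omega> n)"
proof -
  have "integrable S (\<lambda>\<omega>. \<omega> i)" for i
    using integrable_distr_eq[of "\<lambda>\<omega>. \<omega> i" S borel "\<lambda>x. x"] integrable_Q
    by (simp only: distr_step measurable_step measurable_ident measurable_ident_sets)
  then have "integrable S (\<lambda>\<omega>. walk \<omega> n)" unfolding walk_def by (rule Bochner_Integration.integrable_sum)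
  then show ?thesis by (rule integrable_inner_right)
qed

text \<open>Let \<open>q\<close> be this probability. By the Markov property the expected number of times \<open>k < n\<close> whose
position is never approached again to within \<open>r\<close> is \<open>n * q\<close>. Positions of this kind are pairwise
at distance at least \<open>r\<close>, so at most about \<open>2 * e * n / r\<close> of them lie in \<open>[- e * n, e * n]\<close>; and by
Markov's inequality and the \<open>L\<^sup>1\<close> law of large numbers few times \<open>k < n\<close> have a position outside
that interval. So \<open>q\<close> is at most a fixed multiple of \<open>e\<close>, for every \<open>e > 0\<close>.\<close>

lemma prob_no_near_return:
  assumes r: "r > 0"
  shows "P.prob {\<omega>. \<forall>m\<ge>1. r \<le> \<bar>v \<bullet> walk \<omega> m\<bar>} = 0"
proof -
  define R where "R = {\<omega>. \<forall>m\<ge>1. r \<le> \<bar>v \<bullet> walk \<omega> m\<bar>}"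
  have R: "R \<in> sets S" unfolding R_def by (rule pred_sets) measurable
  define q where "q = P.prob R"
  have bound: "q \<le> e * (2 / r + 1)" if e: "e > 0" for e :: real
  proof -
    \<comment> \<open>The rate \<open>e\<^sup>2\<close> survives the division by \<open>e\<close> in Markov's inequality as \<open>e\<close>.\<close>
    obtain C where C: "\<And>n. P.expectation (\<lambda>\<omega>. \<bar>v \<bullet> walk \<omega> n\<bar>) \<le> e\<^sup>2 * n + C"
      using walk_L1_bound[of "e\<^sup>2" v] e by auto
    have main: "n * q \<le> 2 * e * n / r + 2 + (e\<^sup>2 * n + C) / e" if n: "n \<ge> 1" for n :: nat
    proof -
      have Rk [measurable]: "(\<lambda>\<omega>. indicator R (steps_from k \<omega>) :: real) \<in> borel_measurable S" for k
        using R by measurable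
      have ER: "P.expectation (\<lambda>\<omega>. indicator R (steps_from k \<omega>)) = q" for k
      proof -
        have "{\<omega>. steps_from k \<omega> \<in> R} \<in> sets S" by (rule pred_sets) (use R in measurable)
        then have "P.expectation (indicator {\<omega>. steps_from k \<omega> \<in> R}) = P.prob {\<omega>. steps_from k \<omega> \<in> R}"
          by simp
        moreover have "indicator {\<omega>. steps_from k \<omega> \<in> R} = (\<lambda>\<omega>. indicator R (steps_from k \<omega>) :: real)"
          by (auto simp: indicator_def)
        ultimately show ?thesis using prob_shift[OF R] by (simp add: q_def)
      qed
      have Rint: "integrable S (\<lambda>\<omega>. indicator R (steps_from k \<omega>) :: real)" for k
        by (rule P.integrable_const_bound[where B=1]) (auto simp: Rk split: split_indicator)
      have pointwise: "(\<Sum>k<n. indicator R (steps_from k \<omega>))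
          \<le> (2 * (e * n) / r + 2) + (\<Sum>k<n. \<bar>v \<bullet> walk \<omega> k\<bar> / (e * n))" for \<omega>
      proof -
        define I where "I = {k. k < n \<and> steps_from k \<omega> \<in> R \<and> \<bar>v \<bullet> walk \<omega> k\<bar> \<le> e * n}"
        have fin: "finite I" unfolding I_def by simp
        have "real (card I) \<le> 2 * (e * n) / r + 2"
        proof (rule card_separated_le[OF fin r])
          fix k l assume kl: "k \<in> I" "l \<in> I" "k < l"
          have "r \<le> \<bar>v \<bullet> walk (steps_from k \<omega>) (l - k)\<bar>"
            using kl unfolding I_def R_def by auto
          then show "r \<le> \<bar>v \<bullet> walk \<omega> l - v \<bullet> walk \<omega> k\<bar>"
            using kl by (simp add: walk_shift inner_diff_right)
        qed (use e in \<open>auto simp: I_def\<close>)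
        moreover have "(\<Sum>k<n. indicator R (steps_from k \<omega>))
            \<le> (\<Sum>k<n. indicator I k + \<bar>v \<bullet> walk \<omega> k\<bar> / (e * n))"
        proof (rule sum_mono)
          fix k assume k: "k \<in> {..<n}"
          have pos: "e * n > 0" using e n by simp
          show "indicator R (steps_from k \<omega>) \<le> indicator I k + \<bar>v \<bullet> walk \<omega> k\<bar> / (e * n)"
          proof (cases "\<bar>v \<bullet> walk \<omega> k\<bar> \<le> e * n")
            case True
            then show ?thesis using k pos by (auto simp: I_def indicator_def)
          next
            case False
            then have "1 \<le> \<bar>v \<bullet> walk \<omega> k\<bar> / (e * n)" using pos by simp
            then show ?thesis by (auto simp: indicator_def)
          qed
        qed
        moreover have "(\<Sum>k<n. indicator I k) = real (card I)"
        proof -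
          have "{..<n} \<inter> I = I" by (auto simp: I_def)
          then show ?thesis using sum.inter_restrict[of "{..<n}" "\<lambda>_. 1 :: real" I]
            by (simp add: indicator_def)
        qed
        ultimately show ?thesis by (simp add: sum.distrib)
      qed
      have pos: "e * n > 0" using e n by simp
      have "n * q = P.expectation (\<lambda>\<omega>. \<Sum>k<n. indicator R (steps_from k \<omega>))"
        using Rint by (simp add: integral_sum ER)
      also have "\<dots> \<le> P.expectation (\<lambda>\<omega>. (2 * (e * n) / r + 2) + (\<Sum>k<n. \<bar>v \<bullet> walk \<omega> k\<bar> / (e * n)))"
        using Rint integrable_walk_inner by (intro integral_mono pointwise) auto
      also have "\<dots> = (2 * (e * n) / r + 2) + (\<Sum>k<n. P.expectation (\<lambda>\<omega>. \<bar>v \<bullet> walk \<omega> k\<bar>) / (e * n))"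
        using integrable_walk_inner by (simp add: integral_sum)
      also have "(\<Sum>k<n. P.expectation (\<lambda>\<omega>. \<bar>v \<bullet> walk \<omega> k\<bar>) / (e * n)) \<le> (\<Sum>k<n. (e\<^sup>2 * n + C) / (e * n))"
      proof (intro sum_mono divide_right_mono)
        fix k assume "k \<in> {..<n}"
        then have "e\<^sup>2 * k \<le> e\<^sup>2 * n" by (intro mult_left_mono) auto
        then show "P.expectation (\<lambda>\<omega>. \<bar>v \<bullet> walk \<omega> k\<bar>) \<le> e\<^sup>2 * n + C" using C[of k] by linarith
      qed (use pos in simp)
      also have "\<dots> = (e\<^sup>2 * n + C) / e" using n by simp
      finally show ?thesis by simp
    qed
    show ?thesis
    proof (rule ccontr)
      assume neg: "\<not> ?thesis"
      define g where "g = q - e * (2 / r + 1)"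
      have g: "g > 0" using neg by (simp add: g_def)
      obtain n :: nat where n: "(2 + C / e) / g < n" using reals_Archimedean2 by blast
      have "2 + C / e < n * g" using g n by (simp add: pos_divide_less_eq)
      also have "\<dots> \<le> (n + 1) * g" using g by (intro mult_right_mono) auto
      finally have "2 + C / e < (n + 1) * g" by simp
      moreover have "(n + 1) * q \<le> 2 * e * (n + 1) / r + 2 + (e * (n + 1) + C / e)"
        using main[of "n + 1"] e by (simp add: add_divide_distrib power2_eq_square)
      moreover have "(n + 1) * q = (n + 1) * g + 2 * e * (n + 1) / r + e * (n + 1)"
        by (simp add: g_def algebra_simps)
      ultimately show False by linarith
    qed
  qed
  have q0: "q \<le> 0"
  proof (rule field_le_epsilon)
    fix e :: real assume "e > 0"
    moreover have "2 / r + 1 > 0" using r by (simp add: add_pos_pos)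
    ultimately show "q \<le> 0 + e" using bound[of "e / (2 / r + 1)"] by simp
  qed
  have "P.prob R = 0" using q0 unfolding q_def by (rule order.antisym) (rule measure_nonneg)
  then show ?thesis unfolding R_def .
qed

text \<open>The walk starts inside the strip, so finitely many visits would include a last one. After it the
walk would stay away from the position of that visit by a fixed distance, which has probability
zero.\<close>

lemma strip_visited_infinitely_often:
  "AE \<omega> in S. \<forall>n. \<exists>k\<ge>n. \<bar>v \<bullet> walk \<omega> k\<bar> < 1"
proof -
  define R where "R j = {\<omega>. \<forall>m\<ge>1. 1 / real (Suc j) \<le> \<bar>v \<bullet> walk \<omega> m\<bar>}" for j
  have R: "R j \<in> sets S" for j unfolding R_def by (rule pred_sets) measurable
  have "AE \<omega> in S. steps_from k \<omega> \<notin> R j" for k j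
  proof -
    have "P.prob {\<omega>. steps_from k \<omega> \<in> R j} = 0"
      using prob_shift[OF R, of k j] prob_no_near_return[of "1 / real (Suc j)" v] by (simp add: R_def)
    moreover have "{\<omega>. steps_from k \<omega> \<in> R j} \<in> sets S" by (rule pred_sets) (use R in measurable)
    ultimately have "{\<omega>. steps_from k \<omega> \<in> R j} \<in> null_sets S"
      by (simp add: null_sets_def P.emeasure_eq_measure)
    then show ?thesis by (auto dest: AE_not_in)
  qed
  then have "AE \<omega> in S. \<forall>k j. steps_from k \<omega> \<notin> R j" by (simp add: AE_all_countable)
  then show ?thesis
  proof (rule AE_mp, intro AE_I2 impI allI)
    fix \<omega> n assume nR: "\<forall>k j. steps_from k \<omega> \<notin> R j"
    show "\<exists>k\<ge>n. \<bar>v \<bullet> walk \<omega> k\<bar> < 1"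
    proof (rule ccontr)
      assume "\<not> ?thesis"
      then have out: "1 \<le> \<bar>v \<bullet> walk \<omega> k\<bar>" if "k \<ge> n" for k using that by (auto simp: not_less)
      let ?K = "{k. \<bar>v \<bullet> walk \<omega> k\<bar> < 1}"
      define k where "k = Max ?K"
      have "?K \<subseteq> {..n}"
      proof
        fix k assume "k \<in> ?K"
        then show "k \<in> {..n}" using out[of k] by (cases "n \<le> k") auto
      qed
      then have fin: "finite ?K" by (rule finite_subset) simp
      \<comment> \<open>The walk is at the origin at time \<open>0\<close>, so a last visit exists.\<close>
      have "0 \<in> ?K" by simp
      then have k: "\<bar>v \<bullet> walk \<omega> k\<bar> < 1" using Max_in[OF fin] unfolding k_def by blast
      have later: "1 \<le> \<bar>v \<bullet> walk \<omega> (k + m)\<bar>" if "m \<ge> 1" for m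
      proof (rule ccontr)
        assume "\<not> ?thesis"
        then have "k + m \<le> k" unfolding k_def by (intro Max_ge[OF fin]) (simp add: k_def)
        then show False using that by simp
      qed
      obtain j where j: "1 / real (Suc j) < 1 - \<bar>v \<bullet> walk \<omega> k\<bar>"
        using nat_approx_posE[of "1 - \<bar>v \<bullet> walk \<omega> k\<bar>"] k by auto
      have "steps_from k \<omega> \<in> R j"
        unfolding R_def
      proof (intro CollectI allI impI)
        fix m :: nat assume m: "1 \<le> m"
        have "1 - \<bar>v \<bullet> walk \<omega> k\<bar> \<le> \<bar>v \<bullet> walk \<omega> (k + m)\<bar> - \<bar>v \<bullet> walk \<omega> k\<bar>" using later[OF m] by simp
        also have "\<dots> \<le> \<bar>v \<bullet> walk (steps_from k \<omega>) m\<bar>" unfolding walk_shift inner_diff_right by linarith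
        finally show "1 / real (Suc j) \<le> \<bar>v \<bullet> walk (steps_from k \<omega>) m\<bar>" using j by linarith
      qed
      then show False using nR by blast
    qed
  qed
qed

end

section \<open>Reachable positions\<close>

text \<open>If the interior is nonempty, it is dense in \<open>C\<close> and can be separated from the origin; otherwise
\<open>C\<close> lies in a hyperplane, one of whose two normals will do.\<close>

lemma convex_half_space_if_zero_not_interior:
  fixes C :: "'a::euclidean_space set"
  assumes C: "convex C" and z: "0 \<notin> interior C"
  obtains a where "a \<noteq> 0" "\<And>x. x \<in> C \<Longrightarrow> 0 \<le> a \<bullet> x"
proof (cases "interior C = {}")
  case True
  obtain a b where ab: "a \<noteq> 0" "C \<subseteq> {x. a \<bullet> x = b}"
    using empty_interior_subset_hyperplane[OF C True] by blast
  show ?thesis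
    by (rule that[of "if b \<ge> 0 then a else - a"]) (use ab in auto)
next
  case False
  obtain a where a: "a \<noteq> 0" "\<forall>x\<in>interior C. 0 \<le> a \<bullet> x"
    using separating_hyperplane_set_0[OF convex_interior[OF C] z] by blast
  have "closure (interior C) \<subseteq> {x. 0 \<le> a \<bullet> x}"
    using a(2) closed_halfspace_ge[of 0 a] by (intro closure_minimal) auto
  then have "C \<subseteq> {x. 0 \<le> a \<bullet> x}"
    using convex_closure_interior[OF C False] closure_subset by auto
  then show ?thesis using that[of a] a(1) by auto
qed

context random_steps
begin

lemma supp_eq: "supp Q (\<lambda>x. x) = {x. \<forall>U. open U \<longrightarrow> x \<in> U \<longrightarrow> emeasure Q U > 0}"
  using distr_id2[of borel Q] sets_Q by (simp add: supp_def)

text \<open>The complement is a union of open null sets, which the Lindeloef property makes countable.\<close>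

lemma AE_supp: "AE x in Q. x \<in> supp Q (\<lambda>x. x)"
proof -
  let ?F = "{U. open U \<and> emeasure Q U = 0}"
  obtain F where F: "F \<subseteq> ?F" "countable F" "\<Union>F = \<Union>?F"
    using Lindelof[of ?F] by auto
  have "\<Union>F \<in> null_sets Q"
    using F by (intro null_sets_UN'[of F "\<lambda>U. U", simplified]) (auto simp: null_sets_def sets_Q)
  then have "AE x in Q. x \<notin> \<Union>?F" using F(3) AE_not_in by metis
  then show ?thesis by (rule AE_mp) (auto simp: supp_eq zero_less_iff_neq_zero)
qed

text \<open>The set of possible values of the walk, in the sense of Chung and Fuchs. It is an additive
semigroup that contains the support of the steps.\<close>

definition reachable :: "'a set" where
  "reachable = {z. \<exists>n. \<forall>r>0. 0 < P.prob {\<omega>. dist (walk \<omega> n) z < r}}"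

lemma near_sets: "{\<omega>. dist (walk \<omega> n) z < r} \<in> sets S"
  by (rule pred_sets) measurable

lemma zero_reachable: "0 \<in> reachable"
  unfolding reachable_def by (auto intro!: exI[of _ 0])

lemma supp_reachable: "supp Q (\<lambda>x. x) \<subseteq> reachable"
proof
  fix z assume z: "z \<in> supp Q (\<lambda>x. x)"
  have "0 < P.prob {\<omega>. dist (walk \<omega> 1) z < r}" if r: "r > 0" for r
  proof -
    have "emeasure Q (ball z r) = emeasure (distr S borel (\<lambda>\<omega>. \<omega> 0)) (ball z r)"
      by (simp add: distr_step)
    also have "\<dots> = emeasure S {\<omega>. dist (walk \<omega> 1) z < r}"
      by (subst emeasure_distr) (auto simp: walk_def dist_commute intro!: arg_cong[where f="emeasure S"])
    finally have "0 < emeasure S {\<omega>. dist (walk \<omega> 1) z < r}"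
      using z r unfolding supp_eq by (auto dest: spec[of _ "ball z r"])
    then show ?thesis by (simp add: P.emeasure_eq_measure)
  qed
  then show "z \<in> reachable" unfolding reachable_def by blast
qed

lemma reachable_add:
  assumes "y \<in> reachable" "z \<in> reachable"
  shows "y + z \<in> reachable"
proof -
  obtain m n where m: "\<And>r. r > 0 \<Longrightarrow> 0 < P.prob {\<omega>. dist (walk \<omega> m) y < r}"
    and n: "\<And>r. r > 0 \<Longrightarrow> 0 < P.prob {\<omega>. dist (walk \<omega> n) z < r}"
    using assms unfolding reachable_def by auto
  have "0 < P.prob {\<omega>. dist (walk \<omega> (m + n)) (y + z) < r}" if r: "r > 0" for r
  proof -
    let ?A = "{\<omega>. dist (walk \<omega> m) y < r/2}" and ?B = "{\<omega>. dist (walk \<omega> n) z < r/2}"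
    have "0 < P.prob ?A * P.prob ?B" using m[of "r/2"] n[of "r/2"] r by simp
    also have "\<dots> = P.prob {\<omega>. \<omega> \<in> ?A \<and> steps_from m \<omega> \<in> ?B}"
    proof (rule prob_past_future[symmetric, OF near_sets near_sets])
      fix \<omega> \<omega>' :: "nat \<Rightarrow> 'a"
      assume "\<And>i. i < m \<Longrightarrow> \<omega> i = \<omega>' i" "\<omega> \<in> ?A"
      then show "\<omega>' \<in> ?A" using walk_cong[of m \<omega> \<omega>' m] by simp
    qed
    also have "\<dots> \<le> P.prob {\<omega>. dist (walk \<omega> (m + n)) (y + z) < r}"
    proof (rule P.finite_measure_mono[OF subsetI near_sets])
      fix \<omega> assume "\<omega> \<in> {\<omega>. \<omega> \<in> ?A \<and> steps_from m \<omega> \<in> ?B}"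
      then have "norm (walk \<omega> m - y) < r/2" "norm (walk \<omega> (m + n) - walk \<omega> m - z) < r/2"
        by (simp_all add: walk_shift dist_norm)
      from norm_add_less[OF this] show "\<omega> \<in> {\<omega>. dist (walk \<omega> (m + n)) (y + z) < r}"
        by (simp add: dist_norm algebra_simps)
    qed
    finally show ?thesis .
  qed
  then show ?thesis unfolding reachable_def by blast
qed

lemma reachable_combination:
  fixes c :: "'a \<Rightarrow> nat"
  assumes "finite T" "T \<subseteq> supp Q (\<lambda>x. x)"
  shows "(\<Sum>z\<in>T. real (c z) *\<^sub>R z) \<in> reachable"
  using assms
proof (induction T rule: finite_induct)
  case empty then show ?case by (simp add: zero_reachable)
next
  case (insert z T)
  have "real k *\<^sub>R z \<in> reachable" for k
  proof (induction k)
    case (Suc k)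
    then have "z + real k *\<^sub>R z \<in> reachable"
      using reachable_add[of z "real k *\<^sub>R z"] supp_reachable insert by auto
    then show ?case by (simp add: algebra_simps)
  qed (simp add: zero_reachable)
  then show ?case using insert reachable_add by simp
qed

end

locale full_dim_steps = centered_steps +
  assumes full_dim: "genuinely_full_dim Q (\<lambda>x. x)"
begin

text \<open>Otherwise the steps stay in a closed half-space through the origin. Being centred, they then lie
almost surely on its boundary hyperplane, which would contain the support.\<close>

lemma zero_in_interior_hull_supp: "0 \<in> interior (convex hull supp Q (\<lambda>x. x))"
proof (rule ccontr)
  assume "\<not> ?thesis"
  then obtain a where a: "a \<noteq> 0" "\<And>x. x \<in> convex hull supp Q (\<lambda>x. x) \<Longrightarrow> 0 \<le> a \<bullet> x"
    using convex_half_space_if_zero_not_interior[OF convex_convex_hull] by metis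
  have "AE x in Q. 0 \<le> a \<bullet> x"
    using AE_supp by (rule AE_mp) (auto intro!: a(2) hull_inc)
  moreover have "integrable Q (\<lambda>x. a \<bullet> x)" "(LINT x|Q. a \<bullet> x) = 0"
    using integrable_Q mean_Q by simp_all
  ultimately have "AE x in Q. a \<bullet> x = 0"
    using integral_nonneg_eq_0_iff_AE[of Q "\<lambda>x. a \<bullet> x"] by simp
  moreover have op: "open {x. a \<bullet> x \<noteq> 0}"
    by (intro open_Collect_neq continuous_intros)
  ultimately have "emeasure Q {x. a \<bullet> x \<noteq> 0} = 0"
    using sets_Q sets_eq_imp_space_eq[OF sets_Q] by (subst (asm) AE_iff_measurable[OF _ refl]) auto
  then have "supp Q (\<lambda>x. x) \<subseteq> {x. a \<bullet> x = 0}" using op by (auto simp: supp_eq)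
  then show False
    using full_dim subspace_hyperplane[of a] dim_hyperplane[OF a(1)]
    unfolding genuinely_full_dim_def by blast
qed

text \<open>A small multiple of \<open>u\<close> is a convex combination of points \<open>z\<close> of the support. Scaling it up by \<open>t\<close>
and rounding the coefficients to integers gives a reachable point whose distance from the line
spanned by \<open>u\<close> is bounded by the sum of the \<open>norm z\<close>, independently of \<open>t\<close>.\<close>

lemma steep_position_possible:
  assumes u: "norm u = 1" and v: "norm v = 1" and uv: "v \<bullet> u = 0" and K: "K \<ge> 0"
  obtains L where "0 < P.prob {\<omega>. K * (1 + \<bar>v \<bullet> walk \<omega> L\<bar>) < \<bar>u \<bullet> walk \<omega> L\<bar>}"
proof -
  obtain e where e: "e > 0" "cball 0 e \<subseteq> convex hull supp Q (\<lambda>x. x)"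
    using zero_in_interior_hull_supp by (auto simp: mem_interior_cball)
  have "e *\<^sub>R u \<in> convex hull supp Q (\<lambda>x. x)" using e u by (auto intro!: subsetD[OF e(2)])
  then obtain T c where T: "finite T" "T \<subseteq> supp Q (\<lambda>x. x)" "\<And>z. z \<in> T \<Longrightarrow> 0 \<le> c z"
    and sum: "(\<Sum>z\<in>T. c z *\<^sub>R z) = e *\<^sub>R u"
    unfolding convex_hull_explicit by auto
  \<comment> \<open>The summand \<open>1\<close> makes room for the distance between the walk and the reachable point.\<close>
  define B where "B = (\<Sum>z\<in>T. norm z) + 1"
  have B: "B \<ge> 1" unfolding B_def by (simp add: sum_nonneg)
  \<comment> \<open>Chosen so that \<open>t * e - B\<close> exceeds \<open>K * (1 + B)\<close>.\<close>
  define t where "t = (K * (1 + B) + B + 1) / e"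
  have t: "t \<ge> 0" unfolding t_def using K B e by simp
  define p where "p = (\<Sum>z\<in>T. real (nat \<lfloor>t * c z\<rfloor>) *\<^sub>R z)"
  have "norm (p - (t * e) *\<^sub>R u) \<le> B - 1"
  proof -
    have "(t * e) *\<^sub>R u = t *\<^sub>R (\<Sum>z\<in>T. c z *\<^sub>R z)" unfolding sum by simp
    then have "p - (t * e) *\<^sub>R u = (\<Sum>z\<in>T. (real (nat \<lfloor>t * c z\<rfloor>) - t * c z) *\<^sub>R z)"
      unfolding p_def by (simp add: scaleR_sum_right sum_subtractf algebra_simps)
    also have "norm \<dots> \<le> (\<Sum>z\<in>T. norm z)"
    proof (rule sum_norm_le)
      fix z assume "z \<in> T"
      then have "0 \<le> t * c z" using t T(3) by simp
      then have "\<bar>real (nat \<lfloor>t * c z\<rfloor>) - t * c z\<bar> \<le> 1" by linarith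
      then show "norm ((real (nat \<lfloor>t * c z\<rfloor>) - t * c z) *\<^sub>R z) \<le> norm z"
        using mult_right_mono[OF _ norm_ge_zero[of z]] by fastforce
    qed
    finally show ?thesis by (simp add: B_def)
  qed
  moreover have "p \<in> reachable" unfolding p_def by (rule reachable_combination[OF T(1,2)])
  then obtain L where L: "0 < P.prob {\<omega>. dist (walk \<omega> L) p < 1}"
    unfolding reachable_def by (auto dest: spec[of _ 1])
  have "P.prob {\<omega>. dist (walk \<omega> L) p < 1}
      \<le> P.prob {\<omega>. K * (1 + \<bar>v \<bullet> walk \<omega> L\<bar>) < \<bar>u \<bullet> walk \<omega> L\<bar>}"
  proof (rule P.finite_measure_mono[OF subsetI])
    show "{\<omega>. K * (1 + \<bar>v \<bullet> walk \<omega> L\<bar>) < \<bar>u \<bullet> walk \<omega> L\<bar>} \<in> sets S"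
      by (rule pred_sets) measurable
    fix \<omega> assume "\<omega> \<in> {\<omega>. dist (walk \<omega> L) p < 1}"
    then have "norm (walk \<omega> L - p) < 1" by (simp add: dist_norm)
    moreover have "norm (p - (t * e) *\<^sub>R u) \<le> B - 1" by fact
    ultimately have "norm (walk \<omega> L - (t * e) *\<^sub>R u) \<le> B"
      using norm_triangle_ineq[of "walk \<omega> L - p" "p - (t * e) *\<^sub>R u"] by simp
    moreover have "\<bar>u \<bullet> (walk \<omega> L - (t * e) *\<^sub>R u)\<bar> \<le> norm (walk \<omega> L - (t * e) *\<^sub>R u)"
      "\<bar>v \<bullet> (walk \<omega> L - (t * e) *\<^sub>R u)\<bar> \<le> norm (walk \<omega> L - (t * e) *\<^sub>R u)"
      using Cauchy_Schwarz_ineq2[of u "walk \<omega> L - (t * e) *\<^sub>R u"] u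
        Cauchy_Schwarz_ineq2[of v "walk \<omega> L - (t * e) *\<^sub>R u"] v by simp_all
    moreover have "u \<bullet> u = 1" using u by (simp add: dot_square_norm)
    ultimately have "\<bar>u \<bullet> walk \<omega> L - t * e\<bar> \<le> B" "\<bar>v \<bullet> walk \<omega> L\<bar> \<le> B"
      using uv by (simp_all add: inner_diff_right)
    moreover have "t * e = K * (1 + B) + B + 1" unfolding t_def using e by simp
    moreover have "K * (1 + \<bar>v \<bullet> walk \<omega> L\<bar>) \<le> K * (1 + B)"
      using K calculation(2) by (intro mult_left_mono) auto
    ultimately show "\<omega> \<in> {\<omega>. K * (1 + \<bar>v \<bullet> walk \<omega> L\<bar>) < \<bar>u \<bullet> walk \<omega> L\<bar>}" by simp
  qed
  with L show ?thesis by (intro that[of L]) linarith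
qed

end

section \<open>Steep walks\<close>

text \<open>The event through which the direction \<open>u\<close> is reached: in the plane, if \<open>v\<close> is orthogonal to
\<open>u\<close>, the walk enters every cone around the ray spanned by \<open>u\<close>, arbitrarily far out. In contrast
to the event that the directions of the walk accumulate at \<open>u\<close>, it visibly does not depend on the
first steps, since they displace the walk by a bounded amount.\<close>

definition steep :: "'a::real_inner \<Rightarrow> 'a \<Rightarrow> (nat \<Rightarrow> 'a) \<Rightarrow> bool" where
  "steep u v \<omega> \<longleftrightarrow> (\<forall>K::nat. \<exists>n. real K * (1 + \<bar>v \<bullet> walk \<omega> n\<bar>) < u \<bullet> walk \<omega> n)"

lemma steep_iff_real:
  "steep u v \<omega> \<longleftrightarrow> (\<forall>K::real. \<exists>n. K * (1 + \<bar>v \<bullet> walk \<omega> n\<bar>) < u \<bullet> walk \<omega> n)"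
proof
  assume st: "steep u v \<omega>"
  show "\<forall>K::real. \<exists>n. K * (1 + \<bar>v \<bullet> walk \<omega> n\<bar>) < u \<bullet> walk \<omega> n"
  proof
    fix K :: real
    obtain N :: nat where N: "K \<le> N" using real_arch_simple by blast
    obtain n where n: "real N * (1 + \<bar>v \<bullet> walk \<omega> n\<bar>) < u \<bullet> walk \<omega> n"
      using st unfolding steep_def by blast
    have "K * (1 + \<bar>v \<bullet> walk \<omega> n\<bar>) \<le> real N * (1 + \<bar>v \<bullet> walk \<omega> n\<bar>)"
      using N by (intro mult_right_mono) auto
    with n show "\<exists>n. K * (1 + \<bar>v \<bullet> walk \<omega> n\<bar>) < u \<bullet> walk \<omega> n" by (intro exI[of _ n]) linarith
  qed
qed (simp add: steep_def)

text \<open>The constant \<open>K * (1 + c) + c\<close> is large enough to absorb a displacement by \<open>c\<close> both along \<open>u\<close> and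
along \<open>v\<close>.\<close>

lemma slope_perturbation:
  fixes x y u v :: "'a::real_inner"
  assumes u: "norm u = 1" and v: "norm v = 1" and K: "K \<ge> 0" and c: "norm (x - y) \<le> c"
    and steep: "(K * (1 + c) + c) * (1 + \<bar>v \<bullet> x\<bar>) < u \<bullet> x"
  shows "K * (1 + \<bar>v \<bullet> y\<bar>) < u \<bullet> y"
proof -
  have "\<bar>u \<bullet> (x - y)\<bar> \<le> c" "\<bar>v \<bullet> (x - y)\<bar> \<le> c"
    using Cauchy_Schwarz_ineq2[of u "x - y"] Cauchy_Schwarz_ineq2[of v "x - y"] u v c by auto
  then have ux: "u \<bullet> x - c \<le> u \<bullet> y" and vx: "\<bar>v \<bullet> y\<bar> \<le> \<bar>v \<bullet> x\<bar> + c"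
    by (auto simp: inner_diff_right)
  have c0: "c \<ge> 0" using c norm_ge_zero[of "x - y"] by linarith
  have "K * (1 + \<bar>v \<bullet> y\<bar>) \<le> K * ((1 + c) * (1 + \<bar>v \<bullet> x\<bar>))"
  proof (rule mult_left_mono[OF _ K])
    have "0 \<le> c * \<bar>v \<bullet> x\<bar>" using c0 by simp
    then show "1 + \<bar>v \<bullet> y\<bar> \<le> (1 + c) * (1 + \<bar>v \<bullet> x\<bar>)" using vx by (simp add: algebra_simps)
  qed
  also have "\<dots> = (K * (1 + c) + c) * (1 + \<bar>v \<bullet> x\<bar>) - c * (1 + \<bar>v \<bullet> x\<bar>)"
    by (simp add: algebra_simps)
  also have "\<dots> < u \<bullet> x - c"
  proof -
    have "c * 1 \<le> c * (1 + \<bar>v \<bullet> x\<bar>)" using c0 by (intro mult_left_mono) auto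
    then show ?thesis using steep by simp
  qed
  finally show ?thesis using ux by linarith
qed

text \<open>The walk is bounded during the first \<open>k\<close> steps, so a sufficiently steep position comes later.\<close>

lemma steep_late:
  fixes u v :: "'a::real_inner"
  assumes st: "steep u v \<omega>" and u: "norm u = 1"
  obtains n where "n \<ge> k" "K * (1 + \<bar>v \<bullet> walk \<omega> n\<bar>) < u \<bullet> walk \<omega> n"
proof -
  define c where "c = (\<Sum>j<k. norm (walk \<omega> j))"
  obtain n where n: "max K c * (1 + \<bar>v \<bullet> walk \<omega> n\<bar>) < u \<bullet> walk \<omega> n"
    using st unfolding steep_iff_real by blast
  have "n \<ge> k"
  proof (rule ccontr)
    assume "\<not> ?thesis"
    then have "norm (walk \<omega> n) \<le> c" unfolding c_def by (intro member_le_sum) auto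
    moreover have "u \<bullet> walk \<omega> n \<le> norm (walk \<omega> n)"
      using norm_cauchy_schwarz[of u "walk \<omega> n"] u by simp
    moreover have "c * 1 \<le> max K c * (1 + \<bar>v \<bullet> walk \<omega> n\<bar>)"
      by (intro mult_mono) (auto simp: c_def sum_nonneg le_max_iff_disj)
    ultimately show False using n by linarith
  qed
  moreover have "K * (1 + \<bar>v \<bullet> walk \<omega> n\<bar>) \<le> max K c * (1 + \<bar>v \<bullet> walk \<omega> n\<bar>)"
    by (intro mult_right_mono) auto
  ultimately show ?thesis using n that[of n] by linarith
qed

lemma steep_steps_from:
  fixes u v :: "'a::real_inner"
  assumes u: "norm u = 1" and v: "norm v = 1"
  shows "steep u v (steps_from k \<omega>) \<longleftrightarrow> steep u v \<omega>"
proof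
  let ?c = "norm (walk \<omega> k)"
  assume st: "steep u v (steps_from k \<omega>)"
  show "steep u v \<omega>"
    unfolding steep_def
  proof
    fix K :: nat
    obtain m where m: "(K * (1 + ?c) + ?c) * (1 + \<bar>v \<bullet> walk (steps_from k \<omega>) m\<bar>) < u \<bullet> walk (steps_from k \<omega>) m"
      using st unfolding steep_iff_real by blast
    have "K * (1 + \<bar>v \<bullet> walk \<omega> (k + m)\<bar>) < u \<bullet> walk \<omega> (k + m)"
      by (rule slope_perturbation[OF u v _ _ m]) (simp_all add: walk_shift)
    then show "\<exists>n. real K * (1 + \<bar>v \<bullet> walk \<omega> n\<bar>) < u \<bullet> walk \<omega> n" by blast
  qed
next
  let ?c = "norm (walk \<omega> k)"
  assume st: "steep u v \<omega>"
  show "steep u v (steps_from k \<omega>)"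
    unfolding steep_def
  proof
    fix K :: nat
    obtain n where n: "n \<ge> k" "(K * (1 + ?c) + ?c) * (1 + \<bar>v \<bullet> walk \<omega> n\<bar>) < u \<bullet> walk \<omega> n"
      by (rule steep_late[OF st u])
    have "K * (1 + \<bar>v \<bullet> walk (steps_from k \<omega>) (n - k)\<bar>) < u \<bullet> walk (steps_from k \<omega>) (n - k)"
      by (rule slope_perturbation[OF u v _ _ n(2)]) (simp_all add: walk_shift n(1))
    then show "\<exists>m. real K * (1 + \<bar>v \<bullet> walk (steps_from k \<omega>) m\<bar>) < u \<bullet> walk (steps_from k \<omega>) m" by blast
  qed
qed

context full_dim_steps
begin

text \<open>Suppose that the event \<open>G\<close> of staying in the region \<open>\<bar>u \<bullet> x\<bar> \<le> K * (1 + \<bar>v \<bullet> x\<bar>)\<close> for ever has positive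
probability, and let \<open>H n\<close> be the event of having stayed there up to time \<open>n\<close>. At the first visit
to the strip \<open>\<bar>v \<bullet> x\<bar> < 1\<close> from time \<open>n\<close> on, a confined walk is in a fixed bounded set, and from
there it is outside the region \<open>L\<close> steps later with a probability of at least \<open>p > 0\<close>, where \<open>p\<close>
is the same for all \<open>n\<close>. On \<open>G\<close> such a visit takes place almost surely, so \<open>H n - G\<close> has
probability at least \<open>p\<close> times that of \<open>G\<close>. But the probability of \<open>H n\<close> tends to that of \<open>G\<close>.\<close>

lemma prob_confined_eq_0:
  assumes u: "norm u = 1" and v: "norm v = 1" and uv: "v \<bullet> u = 0" and K: "K \<ge> 0"
  shows "P.prob {\<omega>. \<forall>n. \<bar>u \<bullet> walk \<omega> n\<bar> \<le> K * (1 + \<bar>v \<bullet> walk \<omega> n\<bar>)} = 0" (is "P.prob ?G = 0")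
proof (rule ccontr)
  assume "P.prob ?G \<noteq> 0"
  then have pos: "P.prob ?G > 0" by (simp add: zero_less_measure_iff)
  \<comment> \<open>The factor \<open>4\<close> lets a displacement of this slope lead out of the region from any confined
    point of the strip.\<close>
  obtain L where L: "0 < P.prob {\<omega>. (4 * K) * (1 + \<bar>v \<bullet> walk \<omega> L\<bar>) < \<bar>u \<bullet> walk \<omega> L\<bar>}"
    using steep_position_possible[OF u v uv, of "4 * K"] K by auto
  let ?W = "{\<omega>. (4 * K) * (1 + \<bar>v \<bullet> walk \<omega> L\<bar>) < \<bar>u \<bullet> walk \<omega> L\<bar>}"
  define H where "H n = {\<omega>. \<forall>j\<le>n. \<bar>u \<bullet> walk \<omega> j\<bar> \<le> K * (1 + \<bar>v \<bullet> walk \<omega> j\<bar>)}" for n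
  have G: "?G \<in> sets S" by (rule pred_sets) measurable
  have W: "?W \<in> sets S" by (rule pred_sets) measurable
  have H: "H n \<in> sets S" for n unfolding H_def by (rule pred_sets) measurable
  have "(\<lambda>n. P.prob (H n)) \<longlonglongrightarrow> P.prob (\<Inter>n. H n)"
    by (rule P.finite_Lim_measure_decseq) (use H in \<open>auto simp: H_def decseq_def\<close>)
  also have "(\<Inter>n. H n) = ?G" by (auto simp: H_def)
  finally have "\<forall>\<^sub>F n in sequentially. P.prob (H n) < P.prob ?G + P.prob ?W * P.prob ?G"
    using L pos by (intro order_tendstoD(2)) auto
  then obtain n where n: "P.prob (H n) < P.prob ?G + P.prob ?W * P.prob ?G"
    by (auto simp: eventually_sequentially)
  \<comment> \<open>\<open>k\<close> is the first visit to the strip from time \<open>n\<close> on, and the walk has been confined so far.\<close>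
  define D where "D k = {\<omega>. n \<le> k \<and> (\<forall>j. n \<le> j \<longrightarrow> j < k \<longrightarrow> 1 \<le> \<bar>v \<bullet> walk \<omega> j\<bar>)
      \<and> \<bar>v \<bullet> walk \<omega> k\<bar> < 1 \<and> \<omega> \<in> H k}" for k
  have D: "D k \<in> sets S" for k
    unfolding D_def by (rule pred_sets) (use H in measurable)
  define E where "E k = {\<omega>. \<omega> \<in> D k \<and> steps_from k \<omega> \<in> ?W}" for k
  have E: "E k \<in> sets S" for k
    unfolding E_def by (rule pred_sets) (use D W in measurable)
  have disjD: "disjoint_family D"
  proof -
    have "D k \<inter> D l = {}" if "k < l" for k l
      using that by (auto simp: D_def)
    then show ?thesis
      unfolding disjoint_family_on_def by (metis Int_commute nat_neq_iff)
  qed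
  then have disjE: "disjoint_family E"
    unfolding disjoint_family_on_def E_def by blast
  have EP: "P.prob (E k) = P.prob ?W * P.prob (D k)" for k
  proof -
    have "P.prob (E k) = P.prob (D k) * P.prob ?W"
      unfolding E_def
    proof (rule prob_past_future[OF D W])
      fix \<omega> \<omega>' :: "nat \<Rightarrow> 'a"
      assume eq: "\<And>i. i < k \<Longrightarrow> \<omega> i = \<omega>' i" and "\<omega> \<in> D k"
      moreover have "walk \<omega> j = walk \<omega>' j" if "j \<le> k" for j
        using walk_cong[of k \<omega> \<omega>' j] eq that by blast
      ultimately show "\<omega>' \<in> D k" by (auto simp: D_def H_def)
    qed
    then show ?thesis by simp
  qed
  have "(\<lambda>k. P.prob (E k)) sums P.prob (\<Union>k. E k)"
    by (rule P.finite_measure_UNION) (use E disjE in auto)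
  moreover have "(\<lambda>k. P.prob ?W * P.prob (D k)) sums (P.prob ?W * P.prob (\<Union>k. D k))"
    by (intro sums_mult P.finite_measure_UNION) (use D disjD in auto)
  ultimately have UE: "P.prob (\<Union>k. E k) = P.prob ?W * P.prob (\<Union>k. D k)"
    using sums_unique2 unfolding EP by blast
  have "P.prob ?G \<le> P.prob (\<Union>k. D k)"
  proof (rule P.finite_measure_mono_AE)
    show "AE \<omega> in S. \<omega> \<in> ?G \<longrightarrow> \<omega> \<in> (\<Union>k. D k)"
      using strip_visited_infinitely_often[of v]
    proof (rule AE_mp, intro AE_I2 impI)
      fix \<omega> assume "\<forall>n. \<exists>k\<ge>n. \<bar>v \<bullet> walk \<omega> k\<bar> < 1" and "\<omega> \<in> ?G"
      define k where "k = (LEAST k. n \<le> k \<and> \<bar>v \<bullet> walk \<omega> k\<bar> < 1)"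
      have "\<exists>k. n \<le> k \<and> \<bar>v \<bullet> walk \<omega> k\<bar> < 1" using \<open>\<forall>n. \<exists>k\<ge>n. _\<close> by blast
      then have "n \<le> k \<and> \<bar>v \<bullet> walk \<omega> k\<bar> < 1" unfolding k_def by (rule LeastI_ex)
      moreover have "1 \<le> \<bar>v \<bullet> walk \<omega> j\<bar>" if "n \<le> j" "j < k" for j
        using not_less_Least[of j "\<lambda>k. n \<le> k \<and> \<bar>v \<bullet> walk \<omega> k\<bar> < 1"] that
        unfolding k_def by auto
      ultimately have "\<omega> \<in> D k" using \<open>\<omega> \<in> ?G\<close> by (auto simp: D_def H_def)
      then show "\<omega> \<in> (\<Union>k. D k)" by blast
    qed
  qed (use D in auto)
  then have "P.prob ?W * P.prob ?G \<le> P.prob (\<Union>k. E k)"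
    unfolding UE using L by (intro mult_left_mono) auto
  also have "\<dots> \<le> P.prob (H n - ?G)"
  proof (rule P.finite_measure_mono)
    show "(\<Union>k. E k) \<subseteq> H n - ?G"
    proof
      fix \<omega> assume "\<omega> \<in> (\<Union>k. E k)"
      then obtain k where k: "\<omega> \<in> D k" "steps_from k \<omega> \<in> ?W" unfolding E_def by auto
      have "n \<le> k" and vk: "\<bar>v \<bullet> walk \<omega> k\<bar> < 1" and Hk: "\<omega> \<in> H k" using k(1) by (auto simp: D_def)
      then have "\<omega> \<in> H n" by (auto simp: H_def)
      moreover have "\<omega> \<notin> ?G"
      proof
        assume "\<omega> \<in> ?G"
        then have 1: "\<bar>u \<bullet> walk \<omega> (k + L)\<bar> \<le> K * (1 + \<bar>v \<bullet> walk \<omega> (k + L)\<bar>)"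
          and 2: "\<bar>u \<bullet> walk \<omega> k\<bar> \<le> K * (1 + \<bar>v \<bullet> walk \<omega> k\<bar>)" by blast+
        let ?d = "walk (steps_from k \<omega>) L"
        have "K * (1 + \<bar>v \<bullet> walk \<omega> (k + L)\<bar>) \<le> K * (2 + \<bar>v \<bullet> ?d\<bar>)"
          using vk by (intro mult_left_mono K) (simp add: walk_shift inner_diff_right)
        moreover have "K * (1 + \<bar>v \<bullet> walk \<omega> k\<bar>) \<le> K * 2"
          using vk by (intro mult_left_mono K) auto
        moreover have "\<bar>u \<bullet> ?d\<bar> \<le> \<bar>u \<bullet> walk \<omega> (k + L)\<bar> + \<bar>u \<bullet> walk \<omega> k\<bar>"
          by (simp add: walk_shift inner_diff_right)
        moreover have "(4 * K) * (1 + \<bar>v \<bullet> ?d\<bar>) < \<bar>u \<bullet> ?d\<bar>" using k(2) by simp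
        moreover have "0 \<le> K * \<bar>v \<bullet> ?d\<bar>" using K by simp
        ultimately show False using 1 2 by (simp add: algebra_simps)
      qed
      ultimately show "\<omega> \<in> H n - ?G" by blast
    qed
  qed (use H G in auto)
  also have "\<dots> = P.prob (H n) - P.prob ?G"
    by (rule P.finite_measure_Diff) (use H G in \<open>auto simp: H_def\<close>)
  finally show False using n by linarith
qed

text \<open>Almost surely the walk is steep along \<open>u\<close> or along \<open>- u\<close>; by the zero-one law one of the two
alternatives has probability one.\<close>

lemma AE_steep_either:
  assumes u: "norm u = 1" and v: "norm v = 1" and uv: "v \<bullet> u = 0"
  shows "(AE \<omega> in S. steep u v \<omega>) \<or> (AE \<omega> in S. steep (- u) v \<omega>)"
proof -
  have "AE \<omega> in S. \<not> (\<forall>n. \<bar>u \<bullet> walk \<omega> n\<bar> \<le> real K * (1 + \<bar>v \<bullet> walk \<omega> n\<bar>))" for K :: nat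
  proof -
    let ?G = "{\<omega>. \<forall>n. \<bar>u \<bullet> walk \<omega> n\<bar> \<le> real K * (1 + \<bar>v \<bullet> walk \<omega> n\<bar>)}"
    have "?G \<in> sets S" by (rule pred_sets) measurable
    then have "?G \<in> null_sets S"
      using prob_confined_eq_0[OF u v uv, of K] by (simp add: null_sets_def P.emeasure_eq_measure)
    then show ?thesis by (auto dest: AE_not_in)
  qed
  then have unconf: "AE \<omega> in S. \<forall>K::nat. \<not> (\<forall>n. \<bar>u \<bullet> walk \<omega> n\<bar> \<le> real K * (1 + \<bar>v \<bullet> walk \<omega> n\<bar>))"
    by (simp add: AE_all_countable)
  have either: "AE \<omega> in S. steep u v \<omega> \<or> steep (- u) v \<omega>"
    using unconf
  proof (rule AE_mp, intro AE_I2 impI)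
    fix \<omega> assume un: "\<forall>K::nat. \<not> (\<forall>n. \<bar>u \<bullet> walk \<omega> n\<bar> \<le> real K * (1 + \<bar>v \<bullet> walk \<omega> n\<bar>))"
    show "steep u v \<omega> \<or> steep (- u) v \<omega>"
    proof (rule ccontr)
      assume "\<not> ?thesis"
      then obtain K1 K2 :: nat where K1: "\<And>n. u \<bullet> walk \<omega> n \<le> K1 * (1 + \<bar>v \<bullet> walk \<omega> n\<bar>)"
        and K2: "\<And>n. - u \<bullet> walk \<omega> n \<le> K2 * (1 + \<bar>v \<bullet> walk \<omega> n\<bar>)"
        unfolding steep_def by (auto simp: not_less)
      have "\<bar>u \<bullet> walk \<omega> n\<bar> \<le> real (K1 + K2) * (1 + \<bar>v \<bullet> walk \<omega> n\<bar>)" for n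
      proof -
        have "0 \<le> K1 * (1 + \<bar>v \<bullet> walk \<omega> n\<bar>)" "0 \<le> K2 * (1 + \<bar>v \<bullet> walk \<omega> n\<bar>)" by simp_all
        moreover have "real (K1 + K2) * (1 + \<bar>v \<bullet> walk \<omega> n\<bar>)
            = K1 * (1 + \<bar>v \<bullet> walk \<omega> n\<bar>) + K2 * (1 + \<bar>v \<bullet> walk \<omega> n\<bar>)" by (simp add: distrib_right)
        ultimately show ?thesis using K1[of n] K2[of n] by (simp only: inner_minus_left) linarith
      qed
      then show False using un by blast
    qed
  qed
  have meas: "{\<omega>. steep u v \<omega>} \<in> sets S" unfolding steep_def by (rule pred_sets) measurable
  have "(AE \<omega> in S. steep u v \<omega>) \<or> (AE \<omega> in S. \<not> steep u v \<omega>)"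
    using shift_invariant_zero_one[OF meas] steep_steps_from[OF u v] by simp
  then show ?thesis
  proof
    assume "AE \<omega> in S. \<not> steep u v \<omega>"
    with either have "AE \<omega> in S. steep (- u) v \<omega>" by eventually_elim blast
    then show ?thesis ..
  qed blast
qed

end

section \<open>Recurrent directions\<close>

lemma liminf_ereal_eq_0_iff:
  fixes f :: "nat \<Rightarrow> real"
  assumes nonneg: "\<And>n. f n \<ge> 0"
  shows "liminf (\<lambda>n. ereal (f n)) = 0 \<longleftrightarrow> (\<forall>e>0. \<forall>N. \<exists>n\<ge>N. f n < e)"
proof
  assume lim: "liminf (\<lambda>n. ereal (f n)) = 0"
  show "\<forall>e>0. \<forall>N. \<exists>n\<ge>N. f n < e"
  proof (rule ccontr)
    assume "\<not> ?thesis"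
    then obtain e N where e: "e > 0" "\<And>n. n \<ge> N \<Longrightarrow> e \<le> f n" by (auto simp: not_less)
    have "ereal e \<le> liminf (\<lambda>n. ereal (f n))"
      by (rule Liminf_bounded) (use e(2) in \<open>auto simp: eventually_sequentially\<close>)
    then show False using lim e(1) by simp
  qed
next
  assume fr: "\<forall>e>0. \<forall>N. \<exists>n\<ge>N. f n < e"
  have "0 \<le> liminf (\<lambda>n. ereal (f n))"
    by (rule Liminf_bounded) (simp add: nonneg)
  moreover have "\<not> 0 < liminf (\<lambda>n. ereal (f n))"
  proof
    assume "0 < liminf (\<lambda>n. ereal (f n))"
    then obtain e where e: "0 < ereal e" "ereal e < liminf (\<lambda>n. ereal (f n))"
      using ereal_dense2 by blast
    from less_LiminfD[OF e(2)] obtain N where "\<And>n. n \<ge> N \<Longrightarrow> e < f n"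
      by (auto simp: eventually_sequentially)
    then show False using fr e(1) by (metis ereal_less(2) less_asym)
  qed
  ultimately show "liminf (\<lambda>n. ereal (f n)) = 0" by simp
qed

lemma mem_recurrent_directions:
  "u \<in> recurrent_directions M W \<longleftrightarrow>
    norm u = 1 \<and> (AE \<omega> in M. \<forall>e>0. \<forall>N. \<exists>n\<ge>N. norm (sgn (W n \<omega>) - u) < e)"
  by (simp add: recurrent_directions_def liminf_ereal_eq_0_iff)

text \<open>The exceptional null sets of the members of a convergent sequence can be united, and a direction
approximated infinitely often to within \<open>e/2\<close> approximates nearby directions to within \<open>e\<close>.\<close>

lemma closed_recurrent_directions: "closed (recurrent_directions M W)"
  unfolding closed_sequential_limits
proof (intro allI impI, elim conjE)
  fix x l assume x: "\<forall>n. x n \<in> recurrent_directions M W" and lim: "x \<longlonglongrightarrow> l"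
  have "(\<lambda>n. norm (x n)) \<longlonglongrightarrow> norm l" by (rule tendsto_norm[OF lim])
  moreover have "norm (x n) = 1" for n using x by (simp add: mem_recurrent_directions)
  ultimately have "norm l = 1" using LIMSEQ_unique[OF _ tendsto_const] by simp
  moreover have "AE \<omega> in M. \<forall>j. \<forall>e>0. \<forall>N. \<exists>n\<ge>N. norm (sgn (W n \<omega>) - x j) < e"
    using x by (simp add: mem_recurrent_directions AE_all_countable)
  then have "AE \<omega> in M. \<forall>e>0. \<forall>N. \<exists>n\<ge>N. norm (sgn (W n \<omega>) - l) < e"
  proof (rule AE_mp, intro AE_I2 impI allI)
    fix \<omega> and e :: real and N
    assume near: "\<forall>j. \<forall>e>0. \<forall>N. \<exists>n\<ge>N. norm (sgn (W n \<omega>) - x j) < e" and e: "e > 0"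
    obtain j where j: "norm (x j - l) < e/2"
      using LIMSEQ_D[OF lim, of "e/2"] e by auto
    obtain n where "n \<ge> N" "norm (sgn (W n \<omega>) - x j) < e/2" using near e by (meson half_gt_zero)
    then show "\<exists>n\<ge>N. norm (sgn (W n \<omega>) - l) < e"
      using norm_add_less[OF _ j, of "sgn (W n \<omega>) - x j" "e/2"] by auto
  qed
  ultimately show "l \<in> recurrent_directions M W" by (simp add: mem_recurrent_directions)
qed

definition perp :: "real^2 \<Rightarrow> real^2" where
  "perp u = vector [- u $ 2, u $ 1]"

lemma perp_orthonormal:
  assumes "norm u = 1"
  shows "norm (perp u) = 1" "perp u \<bullet> u = 0" "z = (u \<bullet> z) *\<^sub>R u + (perp u \<bullet> z) *\<^sub>R perp u"
proof -
  have one: "u $ 1 * u $ 1 + u $ 2 * u $ 2 = 1"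
    using assms dot_square_norm[of u] by (simp add: inner_vec_def sum_2)
  then show "norm (perp u) = 1"
    by (simp add: perp_def norm_eq_1 inner_vec_def sum_2)
  show "perp u \<bullet> u = 0" by (simp add: perp_def inner_vec_def sum_2)
  have "z $ 1 = (u $ 1 * u $ 1 + u $ 2 * u $ 2) * z $ 1" "z $ 2 = (u $ 1 * u $ 1 + u $ 2 * u $ 2) * z $ 2"
    unfolding one by simp_all
  then show "z = (u \<bullet> z) *\<^sub>R u + (perp u \<bullet> z) *\<^sub>R perp u"
    by (simp add: vec_eq_iff forall_2 perp_def inner_vec_def sum_2 algebra_simps)
qed

lemma perp_minus: "perp (- u) = - perp u"
  by (simp add: perp_def vec_eq_iff forall_2)

text \<open>The vector \<open>z - norm z *\<^sub>R u\<close> has length at most \<open>2 * \<bar>perp u \<bullet> z\<bar>\<close>, which is less than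
\<open>2 * norm z / K\<close>.\<close>

lemma norm_sgn_minus_le:
  assumes u: "norm u = 1" and K: "K > 0" and st: "K * (1 + \<bar>perp u \<bullet> z\<bar>) < u \<bullet> z"
  shows "norm (sgn z - u) \<le> 2 / K"
proof -
  let ?a = "u \<bullet> z" and ?b = "perp u \<bullet> z"
  note on = perp_orthonormal[OF u]
  have Kb: "K * \<bar>?b\<bar> < ?a" using st K by (simp add: algebra_simps)
  have a: "?a > 0" using Kb K by (smt (verit) mult_nonneg_nonneg abs_ge_zero)
  have az: "?a \<le> norm z" using norm_cauchy_schwarz[of u z] u by simp
  have "norm z \<le> norm (?a *\<^sub>R u) + norm (?b *\<^sub>R perp u)"
    by (subst on(3)) (rule norm_triangle_ineq)
  then have za: "norm z \<le> ?a + \<bar>?b\<bar>" using on(1) u a by simp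
  have z0: "norm z > 0" using a az by linarith
  have "norm z *\<^sub>R (sgn z - u) = z - norm z *\<^sub>R u"
    using z0 by (simp add: sgn_div_norm scaleR_diff_right)
  also have "\<dots> = (?a - norm z) *\<^sub>R u + ?b *\<^sub>R perp u"
    using on(3)[of z] by (simp add: algebra_simps)
  also have "norm \<dots> \<le> norm ((?a - norm z) *\<^sub>R u) + norm (?b *\<^sub>R perp u)" by (rule norm_triangle_ineq)
  also have "\<dots> \<le> 2 * \<bar>?b\<bar>" using on(1) u az za by simp
  finally have "norm z * norm (sgn z - u) \<le> 2 * \<bar>?b\<bar>" by simp
  then have "K * (norm z * norm (sgn z - u)) \<le> K * (2 * \<bar>?b\<bar>)" using K by (intro mult_left_mono) auto
  also have "\<dots> \<le> 2 * norm z" using Kb az by simp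
  finally have "norm z * (K * norm (sgn z - u)) \<le> norm z * 2" by (simp add: mult_ac)
  then show ?thesis using z0 K by (simp add: pos_le_divide_eq mult.commute)
qed

lemma steep_imp_direction:
  assumes u: "norm u = 1" and st: "steep u (perp u) \<omega>" and e: "e > 0"
  obtains n where "n \<ge> N" "norm (sgn (walk \<omega> n) - u) < e"
proof -
  obtain n where n: "n \<ge> N" "(4 / e) * (1 + \<bar>perp u \<bullet> walk \<omega> n\<bar>) < u \<bullet> walk \<omega> n"
    by (rule steep_late[OF st u])
  have "norm (sgn (walk \<omega> n) - u) \<le> 2 / (4 / e)"
    by (rule norm_sgn_minus_le[OF u _ n(2)]) (use e in simp)
  also have "\<dots> < e" using e by simp
  finally show ?thesis using that n(1) by blast
qed

text \<open>The walk omits the variable with index \<open>0\<close>. As steepness is invariant under the shift, the whole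
sequence of variables can nevertheless serve as the point of the canonical space.\<close>

lemma random_walk_eq_walk: "random_walk X n \<omega> = walk (steps_from 1 (\<lambda>i. X i \<omega>)) n"
  by (simp add: random_walk_def walk_def steps_from_def sum.atLeast1_atMost_eq)

lemma iid_distr_eq_PiM:
  assumes M: "prob_space M" and iid: "iid M X"
  defines "Q \<equiv> distr M borel (X 0)"
  shows "(\<lambda>\<omega> i. X i \<omega>) \<in> measurable M (Pi\<^sub>M UNIV (\<lambda>_. Q))" (is "?f \<in> _")
    and "distr M (Pi\<^sub>M UNIV (\<lambda>_. Q)) (\<lambda>\<omega> i. X i \<omega>) = Pi\<^sub>M UNIV (\<lambda>_. Q)"
proof -
  interpret prob_space M by fact
  have ind: "indep_vars (\<lambda>_. borel) X UNIV" and law: "distr M borel (X i) = Q" for i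
    using iid unfolding iid_def Q_def by blast+
  have X [measurable]: "X i \<in> borel_measurable M" for i using ind by (auto simp: indep_vars_def2)
  have sets: "sets (Pi\<^sub>M UNIV (\<lambda>_. Q)) = sets (Pi\<^sub>M UNIV (\<lambda>_::nat. borel))"
    by (intro sets_PiM_cong) (simp_all add: Q_def)
  show "?f \<in> measurable M (Pi\<^sub>M UNIV (\<lambda>_. Q))"
    by (rule measurable_abs_UNIV) (simp add: Q_def)
  have "distr M (Pi\<^sub>M UNIV (\<lambda>_. Q)) ?f = distr M (Pi\<^sub>M UNIV (\<lambda>_. borel)) (\<lambda>\<omega>. \<lambda>i\<in>UNIV. X i \<omega>)"
    by (rule distr_cong) (simp_all add: sets restrict_UNIV)
  also have "\<dots> = Pi\<^sub>M UNIV (\<lambda>i. distr M borel (X i))"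
    using indep_vars_iff_distr_eq_PiM'[where I=UNIV and M'="\<lambda>_. borel" and X=X] ind by simp
  finally show "distr M (Pi\<^sub>M UNIV (\<lambda>_. Q)) ?f = Pi\<^sub>M UNIV (\<lambda>_. Q)" by (simp add: law)
qed

lemma recurrent_direction_if_steep:
  fixes X :: "nat \<Rightarrow> 'w \<Rightarrow> real^2"
  assumes M: "prob_space M" and iid: "iid M X" and u: "norm u = 1"
    and st: "AE \<omega> in Pi\<^sub>M UNIV (\<lambda>_. distr M borel (X 0)). steep u (perp u) \<omega>"
  shows "u \<in> recurrent_directions M (random_walk X)"
proof -
  have "AE \<omega> in M. steep u (perp u) (\<lambda>i. X i \<omega>)"
    using AE_distrD[OF iid_distr_eq_PiM(1)[OF M iid]] st iid_distr_eq_PiM(2)[OF M iid] by metis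
  then have "AE \<omega> in M. \<forall>e>0. \<forall>N. \<exists>n\<ge>N. norm (sgn (random_walk X n \<omega>) - u) < e"
  proof (rule AE_mp, intro AE_I2 impI allI)
    fix \<omega> and e :: real and N
    assume "steep u (perp u) (\<lambda>i. X i \<omega>)" and e: "e > 0"
    then have "steep u (perp u) (steps_from 1 (\<lambda>i. X i \<omega>))"
      using steep_steps_from u perp_orthonormal(1)[OF u] by blast
    from steep_imp_direction[OF u this e, of N]
    show "\<exists>n\<ge>N. norm (sgn (random_walk X n \<omega>) - u) < e"
      unfolding random_walk_eq_walk by blast
  qed
  then show ?thesis using u by (simp add: mem_recurrent_directions)
qed

lemma full_dim_steps_distr:
  assumes M: "prob_space M" and X: "X \<in> borel_measurable M"
    and dim: "genuinely_full_dim M X" and int: "integrable M (\<lambda>\<omega>. norm (X \<omega>))"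
    and mean: "(LINT \<omega>|M. X \<omega>) = 0"
  shows "full_dim_steps (distr M borel X)"
proof -
  interpret prob_space M by fact
  let ?Q = "distr M borel X"
  have Q: "prob_space ?Q" by (rule prob_space_distr[OF X])
  interpret product_prob_space "\<lambda>_. ?Q" "UNIV :: nat set" by (rule product_prob_spaceI[OF Q])
  show ?thesis
  proof
    show "integrable ?Q (\<lambda>x. x)"
      using int X by (simp add: integrable_distr_eq integrable_norm_iff)
    show "(LINT x|?Q. x) = 0" using mean X by (simp add: integral_distr)
    have "supp ?Q (\<lambda>x. x) = supp M X" using X by (simp add: supp_def distr_distr comp_def)
    then show "genuinely_full_dim ?Q (\<lambda>x. x)" using dim by (simp add: genuinely_full_dim_def)
  qed simp
qed

theorem proposition5p2:
  fixes M :: "'w measure" and X :: "nat \<Rightarrow> 'w \<Rightarrow> real^2"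
  assumes "prob_space M"
    and "iid M X"
    and "genuinely_full_dim M (X 0)"
    and "integrable M (\<lambda>\<omega>. norm (X 0 \<omega>))"
    and "(LINT \<omega>|M. X 0 \<omega>) = 0"
  shows "(\<forall>\<sigma>. circle_haar \<sigma> \<longrightarrow>
            measure \<sigma> (recurrent_directions M (random_walk X)) \<ge> 1/2 * measure \<sigma> (sphere 0 1)) \<and>
         (distr M borel (X 0) = distr M borel (\<lambda>\<omega>. - X 0 \<omega>) \<longrightarrow>
            recurrent_directions M (random_walk X) = sphere 0 1)"
proof -
  let ?Q = "distr M borel (X 0)" and ?D = "recurrent_directions M (random_walk X)"
  interpret prob_space M by fact
  have ind: "indep_vars (\<lambda>_. borel) X UNIV" and law: "\<And>k. distr M borel (X k) = ?Q"
    using assms(2) unfolding iid_def by blast+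
  have Xm [measurable]: "X k \<in> borel_measurable M" for k using ind by (auto simp: indep_vars_def2)
  interpret Q: full_dim_steps ?Q
    by (rule full_dim_steps_distr) (use assms in auto)
  let ?st = "\<lambda>u. AE \<omega> in Pi\<^sub>M UNIV (\<lambda>_. ?Q). steep u (perp u) \<omega>"
  have either: "?st u \<or> ?st (- u)" if u: "norm u = 1" for u
    using Q.AE_steep_either[OF u perp_orthonormal(1,2)[OF u]]
    by (simp add: steep_def perp_minus)
  have D: "u \<in> ?D" if "norm u = 1" "?st u" for u
    using recurrent_direction_if_steep[OF assms(1,2) that] .
  have Dsub: "?D \<subseteq> sphere 0 1" by (auto simp: recurrent_directions_def)

  have "1/2 * measure \<sigma> (sphere 0 1) \<le> measure \<sigma> ?D" if haar: "circle_haar \<sigma>" for \<sigma>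
  proof -
    have sets: "sets \<sigma> = sets (restrict_space borel (sphere 0 1 :: (real^2) set))"
      and fin: "emeasure \<sigma> (sphere 0 1) < \<infinity>"
      and inv: "\<And>R A. rotation_matrix R \<Longrightarrow> A \<in> sets \<sigma> \<Longrightarrow>
        emeasure \<sigma> ((\<lambda>x. R *v x) ` A) = emeasure \<sigma> A"
      using haar unfolding circle_haar_def by auto
    have closed_sets: "A \<in> sets \<sigma>" if "closed A" "A \<subseteq> sphere 0 1" for A
      unfolding sets using that by (subst sets_restrict_space_iff) auto
    have sp: "space \<sigma> = sphere 0 1"
      using sets_eq_imp_space_eq[OF sets] by (simp add: space_restrict_space)
    interpret \<sigma>: finite_measure \<sigma> by standard (use fin sp in auto)
    have DD: "?D \<in> sets \<sigma>" by (rule closed_sets[OF closed_recurrent_directions Dsub])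
    have mD: "uminus ` ?D \<in> sets \<sigma>"
      by (rule closed_sets[OF closed_negations[OF closed_recurrent_directions]]) (use Dsub in auto)
    \<comment> \<open>In the plane the antipodal map is a rotation.\<close>
    have rot: "rotation_matrix (- mat 1 :: real^2^2)"
      unfolding rotation_matrix_def
      by (simp add: orthogonal_matrix_def det_2 mat_def vec_eq_iff transpose_def matrix_matrix_mult_def sum_2 forall_2)
    have neg: "(\<lambda>x. (- mat 1 :: real^2^2) *v x) = uminus"
      by (rule ext) (simp add: matrix_vector_mult_def mat_def vec_eq_iff forall_2 sum_2)
    have "emeasure \<sigma> (uminus ` ?D) = emeasure \<sigma> ?D" using inv[OF rot DD] unfolding neg .
    then have "measure \<sigma> (uminus ` ?D) = measure \<sigma> ?D" by (simp add: measure_def)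
    moreover have "measure \<sigma> (sphere 0 1) \<le> measure \<sigma> (?D \<union> uminus ` ?D)"
    proof (rule \<sigma>.finite_measure_mono)
      show "sphere 0 1 \<subseteq> ?D \<union> uminus ` ?D"
      proof
        fix u :: "real^2" assume "u \<in> sphere 0 1"
        then have u: "norm u = 1" by simp
        then have "u \<in> ?D \<or> - u \<in> ?D" using either[OF u] D[of u] D[of "- u"] by auto
        then show "u \<in> ?D \<union> uminus ` ?D" using image_eqI[of u uminus "- u" ?D] by auto
      qed
    qed (use DD mD in auto)
    moreover have "measure \<sigma> (?D \<union> uminus ` ?D) \<le> measure \<sigma> ?D + measure \<sigma> (uminus ` ?D)"
      by (rule measure_Un_le[OF DD mD])
    ultimately show ?thesis by simp
  qed
  moreover have "?D = sphere 0 1" if sym: "?Q = distr M borel (\<lambda>\<omega>. - X 0 \<omega>)"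
  proof -
    \<comment> \<open>The reflected walk comes from the same step law, so a steep direction is recurrent for both walks.\<close>
    let ?Y = "\<lambda>k \<omega>. - X k \<omega>"
    have "distr M borel (?Y k) = distr M borel (?Y 0)" for k
    proof -
      have "distr M borel (?Y k) = distr ?Q borel uminus"
        by (subst law[of k, symmetric], subst distr_distr) (simp_all add: comp_def)
      also have "\<dots> = distr M borel (?Y 0)" by (subst distr_distr) (simp_all add: comp_def)
      finally show ?thesis .
    qed
    then have iidY: "iid M ?Y"
      unfolding iid_def using indep_vars_compose2[OF ind, of "\<lambda>_. uminus" "\<lambda>_. borel"] by simp
    have flip: "u \<in> recurrent_directions M (random_walk ?Y) \<longleftrightarrow> - u \<in> ?D" for u
    proof -
      have "norm (sgn (random_walk ?Y n \<omega>) - u) = norm (sgn (random_walk X n \<omega>) - (- u))" for n \<omega>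
        using norm_minus_commute[of "- sgn (random_walk X n \<omega>)" u]
        by (simp add: random_walk_def sum_negf sgn_minus add.commute)
      then show ?thesis by (simp add: mem_recurrent_directions)
    qed
    have both: "u \<in> ?D \<and> - u \<in> ?D" if "norm u = 1" "?st u" for u
      using D[OF that] flip[of u]
        recurrent_direction_if_steep[OF assms(1) iidY that(1) that(2)[unfolded sym]] by blast
    have "u \<in> ?D" if u: "norm u = 1" for u
      using either[OF u] both[of u] both[of "- u"] u by auto
    then show ?thesis using Dsub by auto
  qed
  ultimately show ?thesis by blast
qed

end
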